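(* Let $(X,d)$ be a metric space with completion $\widetilde X$ (whose metric is also denoted $d$) satisfying the following two conditions. (1) There are two points $u,v\in X$ and an infinite family of geodesics between $u$ and $v$ in $\widetilde X$, called marked $uv$-geodesics (not all geodesics between $u$ and $v$ have to be marked), such that condition (2) holds. (2) There is a constant $c>0$ (depending on $X$ only, not on $u_0,v_0$) such that for any two points $u_0$ and $v_0$ lying on a marked $uv$-geodesic there are $n\in\mathbb N$ and points $w_0=u_0,w_1,\dots,w_{n-1},w_n=v_0$ which also lie on some marked $uv$-geodesic, their order on that geodesic coinciding with the order in which they are listed, and points $z_1,\dots,z_n,\widetilde z_1,\dots,\widetilde z_n$ such that: (a) the points $w_0=u_0,z_1,w_1,z_2,\dots,w_{n-1},z_n,w_n=v_0$ lie on a marked $uv$-geodesic and are listed in their order on this geodesic; (b) the points $w_0=u_0,\widetilde z_1,w_1,\widetilde z_2,\dots,w_{n-1},\widetilde z_n,w_n=v_0$ lie on a marked $uv$-geodesic and are listed in their order on this geodesic; (c) $d(w_i,z_i)=d(w_i,\widetilde z_i)$ and $d(w_{i-1},z_i)=d(w_{i-1},\widetilde z_i)$ for $i=1,\dots,n$; (d) $\sum_{i=1}^n d(z_i,\widetilde z_i)\ge c\,d(u_0,v_0)$. Then $(X,d)$ does not admit a bilipschitz embedding into any Banach space with the Radon-Nikodým property.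
   Context: A geodesic between points $u$ and $v$ of a metric space is (the image of) an isometric embedding $\gamma:[0,d(u,v)]\to \widetilde X$ with $\gamma(0)=u$, $\gamma(d(u,v))=v$. The order of points on it is the order in which they are met when travelling along the geodesic (in the direction from $u_0$ to $v_0$). A map $f:X\to Y$ into a Banach space $Y$ is a bilipschitz embedding if there are constants $0<\ell\le L<\infty$ such that $\ell\, d(x,y)\le \|f(x)-f(y)\|\le L\, d(x,y)$ for all $x,y\in X$. A Banach space $Y$ has the Radon-Nikodým property if every $Y$-valued countably additive measure of bounded variation that is absolutely continuous with respect to a finite positive measure $\mu$ has a Bochner-integrable density with respect to $\mu$. (By Chatterji's theorem this is equivalent to almost everywhere norm convergence of every uniformly bounded $Y$-valued martingale on $[0,1]$.) *)

theory Defs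
  imports "HOL-Analysis.Analysis"
begin

text \<open>A completion of the metric space \<open>'a\<close> is given by an isometric map \<open>\<iota>\<close> with dense
  range into a complete metric space; it is unique up to isometry.\<close>

definition is_completion :: "('a::metric_space \<Rightarrow> 'b::complete_space) \<Rightarrow> bool" where
  "is_completion \<iota> \<longleftrightarrow> (\<forall>x y. dist (\<iota> x) (\<iota> y) = dist x y) \<and> closure (range \<iota>) = UNIV"

text \<open>\<open>geodesic_param u v \<gamma> S\<close>: the set \<open>S\<close> is a geodesic between \<open>u\<close> and \<open>v\<close>, with
  parametrization \<open>\<gamma>\<close>. Geodesics are treated as sets, because \<open>\<gamma>\<close> is unconstrained
  outside its interval, so that counting functions would overcount them.\<close>

definition geodesic_param :: "'b::metric_space \<Rightarrow> 'b \<Rightarrow> (real \<Rightarrow> 'b) \<Rightarrow> 'b set \<Rightarrow> bool" where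
  "geodesic_param u v \<gamma> S \<longleftrightarrow>
     \<gamma> 0 = u \<and> \<gamma> (dist u v) = v \<and>
     (\<forall>s\<in>{0..dist u v}. \<forall>t\<in>{0..dist u v}. dist (\<gamma> s) (\<gamma> t) = \<bar>s - t\<bar>) \<and>
     S = \<gamma> ` {0..dist u v}"

definition is_geodesic :: "'b::metric_space \<Rightarrow> 'b \<Rightarrow> 'b set \<Rightarrow> bool" where
  "is_geodesic u v S \<longleftrightarrow> (\<exists>\<gamma>. geodesic_param u v \<gamma> S)"

text \<open>The points of the list \<open>ps\<close> lie on the \<open>uv\<close>-geodesic \<open>S\<close> and are met in the listed order
  (repetitions allowed) when travelling along \<open>S\<close> in one of its two directions. If the list
  runs from \<open>u\<^sub>0\<close> to \<open>v\<^sub>0\<close>, this is the direction from \<open>u\<^sub>0\<close> to \<open>v\<^sub>0\<close>.\<close>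

definition listed_in_order :: "'b::metric_space \<Rightarrow> 'b \<Rightarrow> 'b set \<Rightarrow> 'b list \<Rightarrow> bool" where
  "listed_in_order u v S ps \<longleftrightarrow>
     (\<exists>\<gamma> ts. geodesic_param u v \<gamma> S \<and> set ts \<subseteq> {0..dist u v} \<and>
             (sorted ts \<or> sorted (rev ts)) \<and> ps = map \<gamma> ts)"

text \<open>\<open>interleave n w z\<close> is the list \<open>w 0, z 1, w 1, z 2, \<dots>, w (n - 1), z n, w n\<close>.\<close>

definition interleave :: "nat \<Rightarrow> (nat \<Rightarrow> 'b) \<Rightarrow> (nat \<Rightarrow> 'b) \<Rightarrow> 'b list" where
  "interleave n w z = w 0 # concat (map (\<lambda>i. [z i, w i]) [1..<Suc n])"

definition bilipschitz_embedding :: "('a::metric_space \<Rightarrow> 'c::real_normed_vector) \<Rightarrow> bool" where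
  "bilipschitz_embedding f \<longleftrightarrow>
     (\<exists>l L. 0 < l \<and> l \<le> L \<and>
        (\<forall>x y. l * dist x y \<le> norm (f x - f y) \<and> norm (f x - f y) \<le> L * dist x y))"

text \<open>The library's \<^const>\<open>has_bochner_integral\<close> requires a second countable range space.
  For arbitrary Banach spaces, Borel measurability has to be replaced by strong measurability
  (almost everywhere convergence of simple functions).\<close>

definition has_strong_bochner_integral ::
    "'w measure \<Rightarrow> ('w \<Rightarrow> 'c::real_normed_vector) \<Rightarrow> 'c \<Rightarrow> bool" where
  "has_strong_bochner_integral M f x \<longleftrightarrow>
     (\<exists>s. (\<forall>i. Bochner_Integration.simple_bochner_integrable M (s i)) \<and>
          (AE \<omega> in M. (\<lambda>i. s i \<omega>) \<longlonglongrightarrow> f \<omega>) \<and>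
          (\<lambda>i. \<integral>\<^sup>+\<omega>. ennreal (norm (f \<omega> - s i \<omega>)) \<partial>M) \<longlonglongrightarrow> 0 \<and>
          (\<lambda>i. Bochner_Integration.simple_bochner_integral M (s i)) \<longlonglongrightarrow> x)"

definition countably_additive_vm :: "'w measure \<Rightarrow> ('w set \<Rightarrow> 'c::real_normed_vector) \<Rightarrow> bool" where
  "countably_additive_vm M F \<longleftrightarrow>
     (\<forall>A :: nat \<Rightarrow> 'w set. range A \<subseteq> sets M \<longrightarrow> disjoint_family A \<longrightarrow>
        (\<lambda>n. F (A n)) sums F (\<Union>n. A n))"

definition bounded_variation_vm :: "'w measure \<Rightarrow> ('w set \<Rightarrow> 'c::real_normed_vector) \<Rightarrow> bool" where
  "bounded_variation_vm M F \<longleftrightarrow>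
     (\<exists>B. \<forall>P. finite P \<and> P \<subseteq> sets M \<and> partition_on (space M) P \<longrightarrow> (\<Sum>A\<in>P. norm (F A)) \<le> B)"

definition absolutely_continuous_vm :: "'w measure \<Rightarrow> ('w set \<Rightarrow> 'c::real_normed_vector) \<Rightarrow> bool" where
  "absolutely_continuous_vm M F \<longleftrightarrow> (\<forall>A\<in>null_sets M. F A = 0)"

text \<open>In the density clause, the case \<open>A = space M\<close> expresses Bochner integrability of \<open>g\<close>.

  A definition cannot quantify over types, so the finite measure spaces considered are those
  (with arbitrary \<open>\<sigma>\<close>-algebra and measure) whose underlying set is a set of reals. They include
  \<open>[0,1]\<close> with Lebesgue measure, for which the property is classically known to be equivalent
  to the property for all finite measure spaces.\<close>

definition radon_nikodym_property :: "'c::banach itself \<Rightarrow> bool" where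
  "radon_nikodym_property (_ :: 'c itself) \<longleftrightarrow>
     (\<forall>(M :: real measure) (F :: real set \<Rightarrow> 'c).
        finite_measure M \<longrightarrow> countably_additive_vm M F \<longrightarrow> bounded_variation_vm M F \<longrightarrow>
        absolutely_continuous_vm M F \<longrightarrow>
        (\<exists>g. \<forall>A\<in>sets M. has_strong_bochner_integral M (\<lambda>\<omega>. indicator A \<omega> *\<^sub>R g \<omega>) (F A)))"

end

theory Submission
  imports Defs
begin

text \<open>
  A bilipschitz embedding extends to the completion. Starting from the pair \<open>u, v\<close>, replace each
  pair \<open>p, q\<close> on a marked geodesic by the consecutive pairs of the chain
  \<open>w\<^sub>0, y\<^sub>1, w\<^sub>1, \<dots>, y\<^sub>n, w\<^sub>n\<close>, where \<open>y\<^sub>i\<close> is whichever of \<open>z\<^sub>i\<close> and its twin moves the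
  difference quotient of the embedding further away from that of \<open>p, q\<close>. Iterating gives a tree of
  subintervals of \<open>[0, d(u, v))\<close> on which the difference quotients form a bounded martingale whose
  consecutive terms stay a fixed \<open>L\<^sup>1\<close>-distance apart.

  Its integrals over any measurable \<open>A\<close> converge, because the scalar martingale of the conditional
  probabilities of \<open>A\<close> has orthogonal increments and hence is Cauchy in \<open>L\<^sup>2\<close>. The limit is a vector
  measure, and the martingale consists of the conditional expectations of its density. Approximating
  the density by a simple function, the \<open>L\<^sup>2\<close> argument shows that the increments tend to \<open>0\<close> in
  \<open>L\<^sup>1\<close>, a contradiction.
\<close>

section \<open>Vector measures from additive trees\<close>

text \<open>A martingale in tree form: its value on \<open>S j\<close> is \<open>\<Delta> j\<close>
  divided by the measure of \<open>S j\<close>. Storing the integral \<open>\<Delta> j\<close>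
  instead of that quotient turns the martingale property into plain additivity over children. The
  generations are recovered from \<open>ch\<close> by \<open>desc\<close>.\<close>

locale additive_tree = finite_measure M
  for M :: "'w measure" +
  fixes V :: "'n set" and S :: "'n \<Rightarrow> 'w set" and ch :: "'n \<Rightarrow> 'n set"
    and \<Delta> :: "'n \<Rightarrow> 'c::banach" and L :: real and r :: 'n
  assumes root: "r \<in> V" "S r = space M"
    and S_sets: "j \<in> V \<Longrightarrow> S j \<in> sets M"
    and S_pos: "j \<in> V \<Longrightarrow> 0 < measure M (S j)"
    and ch_subset: "j \<in> V \<Longrightarrow> ch j \<subseteq> V"
    and ch_finite: "j \<in> V \<Longrightarrow> finite (ch j)"
    and ch_disjoint: "j \<in> V \<Longrightarrow> disjoint_family_on S (ch j)"
    and ch_Union: "j \<in> V \<Longrightarrow> (\<Union>i\<in>ch j. S i) = S j"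
    and \<Delta>_ch: "j \<in> V \<Longrightarrow> \<Delta> j = (\<Sum>i\<in>ch j. \<Delta> i)"
    and \<Delta>_bound: "j \<in> V \<Longrightarrow> norm (\<Delta> j) \<le> L * measure M (S j)"
begin

text \<open>Applies to the children of a node and to every later generation alike. As nodes of
  \<open>V\<close> have positive measure, disjointness of the indexed family makes \<open>S\<close>
  injective on \<open>C\<close>.\<close>

definition splits :: "'n \<Rightarrow> 'n set \<Rightarrow> bool" where
  "splits j C \<longleftrightarrow> finite C \<and> C \<subseteq> V \<and> disjoint_family_on S C \<and> (\<Union>i\<in>C. S i) = S j"

primrec desc :: "nat \<Rightarrow> 'n \<Rightarrow> 'n set" where
  "desc 0 j = {j}"
| "desc (Suc n) j = (\<Union>i\<in>desc n j. ch i)"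

text \<open>The conditional probability of \<open>A\<close> given \<open>S i\<close>. For fixed
  measurable \<open>A\<close>, its values along the generations form a scalar martingale.\<close>

definition avg :: "'w set \<Rightarrow> 'n \<Rightarrow> real" where
  "avg A i = measure M (A \<inter> S i) / measure M (S i)"

text \<open>The squared L2 norm of the conditional expectation of the indicator of \<open>A\<close>
  at generation \<open>k\<close>.\<close>

definition energy :: "'w set \<Rightarrow> nat \<Rightarrow> real" where
  "energy A k = (\<Sum>i\<in>desc k r. measure M (S i) * (avg A i)\<^sup>2)"

text \<open>The L1 distance between the conditional expectations of the indicator of
  \<open>A\<close> at generations \<open>k\<close> and \<open>k + n\<close>.\<close>

definition osc :: "'w set \<Rightarrow> nat \<Rightarrow> nat \<Rightarrow> real" where
  "osc A k n = (\<Sum>j\<in>desc k r. \<Sum>i\<in>desc n j. measure M (S i) * \<bar>avg A i - avg A j\<bar>)"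

text \<open>The integral over \<open>A\<close> of the vector-valued martingale at generation
  \<open>k\<close>.\<close>

definition charge_approx :: "nat \<Rightarrow> 'w set \<Rightarrow> 'c" where
  "charge_approx k A = (\<Sum>i\<in>desc k r. avg A i *\<^sub>R \<Delta> i)"

definition charge :: "'w set \<Rightarrow> 'c" where
  "charge A = lim (\<lambda>k. charge_approx k A)"

section \<open>Partitions of node sets by descendants\<close>

lemma splits_ch: "j \<in> V \<Longrightarrow> splits j (ch j)"
  by (simp add: splits_def ch_subset ch_finite ch_disjoint ch_Union)

lemma splits_subset: "splits j C \<Longrightarrow> i \<in> C \<Longrightarrow> S i \<subseteq> S j"
  unfolding splits_def by blast

lemma splits_Union:
  assumes C: "splits j C" and D: "\<And>i. i \<in> C \<Longrightarrow> splits i (D i)"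
  shows "splits j (\<Union>i\<in>C. D i)"
proof -
  have "disjoint_family_on S (\<Union>i\<in>C. D i)"
    unfolding disjoint_family_on_def
  proof safe
    fix l i l' i' x
    assume *: "i \<in> C" "l \<in> D i" "i' \<in> C" "l' \<in> D i'" "l \<noteq> l'" "x \<in> S l" "x \<in> S l'"
    then have "x \<in> S i" "x \<in> S i'" using splits_subset[OF D] by blast+
    then have "i = i'" using * C unfolding splits_def disjoint_family_on_def by blast
    then show "x \<in> {}" using * D[of i] unfolding splits_def disjoint_family_on_def by blast
  qed
  moreover have "(\<Union>l\<in>(\<Union>i\<in>C. D i). S l) = (\<Union>i\<in>C. S i)"
    using D unfolding splits_def by (simp add: UN_UN_flatten)
  ultimately show ?thesis
    using C D unfolding splits_def by auto
qed

lemma splits_desc: "j \<in> V \<Longrightarrow> splits j (desc n j)"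
proof (induction n)
  case 0
  then show ?case by (simp add: splits_def disjoint_family_on_def)
next
  case (Suc n)
  then have n: "splits j (desc n j)" by simp
  then have "splits i (ch i)" if "i \<in> desc n j" for i
    using that by (intro splits_ch) (auto simp: splits_def)
  then show ?case
    using splits_Union[OF n] by simp
qed

lemma desc_subset: "j \<in> V \<Longrightarrow> desc n j \<subseteq> V"
  using splits_desc[of j n] by (simp add: splits_def)

lemma desc_finite: "j \<in> V \<Longrightarrow> finite (desc n j)"
  using splits_desc[of j n] by (simp add: splits_def)

lemma desc_V: "i \<in> desc k r \<Longrightarrow> i \<in> V"
  using desc_subset[OF root(1)] by blast

lemma desc_add: "desc (k + n) j = (\<Union>i\<in>desc k j. desc n i)"
  by (induction n) auto

text \<open>Distinct nodes of \<open>C\<close> cannot share a node \<open>l\<close> of their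
  refinements: \<open>S l\<close> would lie in the intersection of two disjoint sets, against its
  positive measure. Hence the double sum counts every node once.\<close>

lemma sum_splits_Union:
  assumes C: "splits j C" and D: "\<And>i. i \<in> C \<Longrightarrow> splits i (D i)"
  shows "(\<Sum>l\<in>(\<Union>i\<in>C. D i). h l) = (\<Sum>i\<in>C. \<Sum>l\<in>D i. h l)"
proof (rule sum.UNION_disjoint)
  show "\<forall>i\<in>C. \<forall>i'\<in>C. i \<noteq> i' \<longrightarrow> D i \<inter> D i' = {}"
  proof safe
    fix i i' l assume *: "i \<in> C" "i' \<in> C" "i \<noteq> i'" "l \<in> D i" "l \<in> D i'"
    then have "S l \<subseteq> S i \<inter> S i'" using splits_subset[OF D] by blast
    also have "\<dots> = {}" using * C unfolding splits_def disjoint_family_on_def by blast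
    finally have "measure M (S l) = 0" by simp
    moreover have "l \<in> V" using * D[of i] by (auto simp: splits_def)
    ultimately show "l \<in> {}" using S_pos[of l] by simp
  qed
qed (use C D in \<open>auto simp: splits_def\<close>)

lemma sum_desc_add:
  "(\<Sum>l\<in>desc (k + n) r. h l) = (\<Sum>i\<in>desc k r. \<Sum>l\<in>desc n i. h l)"
  unfolding desc_add
  by (rule sum_splits_Union[OF splits_desc[OF root(1)] splits_desc]) (rule desc_V)

lemma \<Delta>_desc: "j \<in> V \<Longrightarrow> \<Delta> j = (\<Sum>i\<in>desc n j. \<Delta> i)"
proof (induction n)
  case (Suc n)
  have "(\<Sum>i\<in>desc (Suc n) j. \<Delta> i) = (\<Sum>i\<in>desc n j. \<Sum>l\<in>ch i. \<Delta> l)"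
    using sum_splits_Union[OF splits_desc[OF Suc.prems, of n], of ch \<Delta>] splits_ch
      desc_subset[OF Suc.prems, of n] by auto
  also have "\<dots> = (\<Sum>i\<in>desc n j. \<Delta> i)"
    using desc_subset[OF Suc.prems, of n] by (intro sum.cong refl \<Delta>_ch[symmetric]) auto
  finally show ?case using Suc by simp
qed simp

lemma measure_splits:
  assumes "splits j C" "A \<in> sets M"
  shows "measure M (A \<inter> S j) = (\<Sum>i\<in>C. measure M (A \<inter> S i))"
proof -
  have "A \<inter> S j = (\<Union>i\<in>C. A \<inter> S i)"
    using assms(1) by (auto simp: splits_def)
  also have "measure M \<dots> = (\<Sum>i\<in>C. measure M (A \<inter> S i))"
    using assms S_sets unfolding splits_def disjoint_family_on_def
    by (intro finite_measure_finite_Union) (auto simp: disjoint_family_on_def, blast)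
  finally show ?thesis .
qed

lemma measure_splits': "splits j C \<Longrightarrow> j \<in> V \<Longrightarrow> measure M (S j) = (\<Sum>i\<in>C. measure M (S i))"
proof -
  assume *: "splits j C" "j \<in> V"
  then have "S i \<subseteq> space M" if "i \<in> V" for i
    using S_sets[OF that] sets.sets_into_space by blast
  then have "space M \<inter> S i = S i" if "i \<in> V" for i
    using that by blast
  then show ?thesis
    using measure_splits[OF *(1) sets.top] * by (simp add: splits_def subset_iff)
qed

section \<open>Conditional averages and their energy\<close>

lemma measure_avg: "j \<in> V \<Longrightarrow> measure M (S j) * avg A j = measure M (A \<inter> S j)"
  using S_pos[of j] by (simp add: avg_def)

lemma avg_nonneg: "0 \<le> avg A j"
  by (simp add: avg_def)

lemma avg_le_1: "j \<in> V \<Longrightarrow> avg A j \<le> 1"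
  using finite_measure_mono[of "A \<inter> S j" "S j"] S_sets S_pos[of j]
  by (auto simp: avg_def divide_le_eq_1)

text \<open>\<open>avg A j\<close> is the weighted mean of the \<open>avg A i\<close>, so the mixed
  term of the expanded square collapses and only the difference of second moments remains.\<close>

lemma variance:
  assumes C: "splits j C" and j: "j \<in> V" and A: "A \<in> sets M"
  shows "(\<Sum>i\<in>C. measure M (S i) * (avg A i - avg A j)\<^sup>2) =
    (\<Sum>i\<in>C. measure M (S i) * (avg A i)\<^sup>2) - measure M (S j) * (avg A j)\<^sup>2"
proof -
  have CV: "i \<in> V" if "i \<in> C" for i using that C by (auto simp: splits_def)
  have "(\<Sum>i\<in>C. measure M (S i) * (avg A i - avg A j)\<^sup>2) =
     (\<Sum>i\<in>C. measure M (S i) * (avg A i)\<^sup>2 - 2 * avg A j * measure M (A \<inter> S i)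
        + (avg A j)\<^sup>2 * measure M (S i))"
    by (intro sum.cong refl) (simp add: measure_avg[OF CV, symmetric] power2_eq_square algebra_simps)
  also have "\<dots> = (\<Sum>i\<in>C. measure M (S i) * (avg A i)\<^sup>2) - 2 * avg A j * measure M (A \<inter> S j)
        + (avg A j)\<^sup>2 * measure M (S j)"
    by (simp add: sum.distrib sum_subtractf sum_distrib_left[symmetric]
        measure_splits[OF C A] measure_splits'[OF C j])
  finally show ?thesis
    by (simp add: measure_avg[OF j, symmetric] power2_eq_square)
qed

text \<open>Orthogonality of martingale increments: the variance identity summed over the nodes of
  generation \<open>k\<close>.\<close>

lemma energy_diff:
  assumes A: "A \<in> sets M"
  shows "energy A (k + n) - energy A k =
    (\<Sum>j\<in>desc k r. \<Sum>i\<in>desc n j. measure M (S i) * (avg A i - avg A j)\<^sup>2)"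
  unfolding energy_def sum_desc_add sum_subtractf[symmetric]
  by (intro sum.cong refl variance[symmetric] splits_desc desc_V A)

lemma energy_le: "energy A k \<le> measure M (space M)"
proof -
  have "energy A k \<le> (\<Sum>i\<in>desc k r. measure M (S i))"
    unfolding energy_def
    by (intro sum_mono mult_left_le power_le_one avg_nonneg avg_le_1 desc_V) auto
  also have "\<dots> = measure M (space M)"
    using measure_splits'[OF splits_desc[OF root(1)] root(1)] root(2) by simp
  finally show ?thesis .
qed

text \<open>Each generation adds a sum of squares, and the total mass is an upper bound.\<close>

lemma convergent_energy:
  assumes A: "A \<in> sets M"
  shows "convergent (energy A)"
proof -
  have "incseq (energy A)"
  proof (rule incseq_SucI)
    fix k
    have "0 \<le> energy A (k + 1) - energy A k"
      unfolding energy_diff[OF A] by (intro sum_nonneg) auto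
    then show "energy A k \<le> energy A (Suc k)" by simp
  qed
  then show ?thesis
    using energy_le incseq_convergent[of "energy A"] convergentI by metis
qed

text \<open>The inequality \<open>\<bar>y\<bar> \<le> \<eta> + y\<^sup>2 / \<eta>\<close>, weighted
  by the measures of the nodes, takes the place of Cauchy-Schwarz in passing from L2 to L1.\<close>

lemma osc_le:
  assumes A: "A \<in> sets M" and "\<eta> > 0"
  shows "osc A k n \<le> \<eta> * measure M (space M) + (energy A (k + n) - energy A k) / \<eta>"
proof -
  have *: "x * \<bar>y\<bar> \<le> \<eta> * x + x * y\<^sup>2 / \<eta>" if "0 \<le> x" for x y :: real
  proof -
    have "\<eta> * \<bar>y\<bar> \<le> \<eta>\<^sup>2 + y\<^sup>2"
      using sum_squares_bound[of \<eta> "\<bar>y\<bar>"] \<open>\<eta> > 0\<close> mult_nonneg_nonneg[of \<eta> "\<bar>y\<bar>"]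
      unfolding power2_abs by linarith
    then have "\<bar>y\<bar> \<le> \<eta> + y\<^sup>2 / \<eta>"
      using \<open>\<eta> > 0\<close> by (simp add: field_simps power2_eq_square)
    from mult_left_mono[OF this that] show ?thesis by (simp add: algebra_simps)
  qed
  have "osc A k n \<le> (\<Sum>j\<in>desc k r. \<Sum>i\<in>desc n j. \<eta> * measure M (S i)
      + measure M (S i) * (avg A i - avg A j)\<^sup>2 / \<eta>)"
    unfolding osc_def by (intro sum_mono *) auto
  also have "\<dots> = \<eta> * (\<Sum>i\<in>desc (k + n) r. measure M (S i)) + (energy A (k + n) - energy A k) / \<eta>"
    unfolding energy_diff[OF A] sum_desc_add
    by (simp add: sum.distrib sum_distrib_left sum_divide_distrib)
  also have "(\<Sum>i\<in>desc (k + n) r. measure M (S i)) = measure M (space M)"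
    using measure_splits'[OF splits_desc[OF root(1)] root(1)] root(2) by simp
  finally show ?thesis .
qed

lemma osc_small:
  assumes A: "A \<in> sets M" and "\<delta> > 0"
  shows "\<exists>K. \<forall>k\<ge>K. \<forall>n. osc A k n < \<delta>"
proof -
  \<comment> \<open>The summand 1 makes room for the energy term: the final bound
    \<open>\<eta> * measure M (space M) + \<eta>\<close> is \<open>\<eta> * B\<close>, that is
    \<open>\<delta> / 2\<close>.\<close>
  define B where "B = measure M (space M) + 1"
  have B: "B > 0" unfolding B_def by (intro add_nonneg_pos) auto
  define \<eta> where "\<eta> = \<delta> / (2 * B)"
  have \<eta>: "\<eta> > 0" using \<open>\<delta> > 0\<close> B by (simp add: \<eta>_def)
  have "Cauchy (energy A)" using convergent_energy[OF A] by (rule convergent_Cauchy)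
  \<comment> \<open>The tolerance is \<open>\<eta> * \<eta>\<close> because \<open>osc_le\<close>
    divides the energy difference by \<open>\<eta>\<close>. The Cauchy property makes the bound
    uniform in \<open>n\<close>.\<close>
  then obtain K where K: "\<And>m n. m \<ge> K \<Longrightarrow> n \<ge> K \<Longrightarrow> norm (energy A m - energy A n) < \<eta> * \<eta>"
    using CauchyD[of "energy A" "\<eta> * \<eta>"] \<eta> by auto
  have "osc A k n < \<delta>" if "k \<ge> K" for k n
  proof -
    have "(energy A (k + n) - energy A k) / \<eta> < \<eta>"
      using K[of "k + n" k] that \<eta> by (simp add: divide_less_eq)
    then have "osc A k n < \<eta> * measure M (space M) + \<eta>"
      using osc_le[OF A \<eta>, of k n] by linarith
    also have "\<dots> = \<eta> * B" by (simp add: B_def algebra_simps)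
    also have "\<dots> = \<delta> / 2" using B by (simp add: \<eta>_def)
    finally show ?thesis using \<open>\<delta> > 0\<close> by simp
  qed
  then show ?thesis by blast
qed

section \<open>The limiting vector measure\<close>

lemma L_nonneg: "0 \<le> L"
  using \<Delta>_bound[OF root(1)] S_pos[OF root(1)] norm_ge_zero[of "\<Delta> r"]
  by (metis linorder_not_less mult_neg_pos order_less_le_trans)

text \<open>Distributing \<open>\<Delta> j\<close> over its descendants expresses the difference
  through the scalars \<open>avg A i - avg A j\<close>. Thus the L1 Cauchy property of a scalar
  martingale gives convergence of the integrals in an arbitrary Banach space.\<close>

lemma charge_approx_diff:
  "norm (charge_approx (k + n) A - charge_approx k A) \<le> L * osc A k n"
proof -
  have "charge_approx (k + n) A - charge_approx k A =
      (\<Sum>j\<in>desc k r. \<Sum>i\<in>desc n j. (avg A i - avg A j) *\<^sub>R \<Delta> i)"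
    unfolding charge_approx_def sum_desc_add sum_subtractf[symmetric]
  proof (intro sum.cong refl)
    fix j assume "j \<in> desc k r"
    then have "\<Delta> j = (\<Sum>i\<in>desc n j. \<Delta> i)" by (intro \<Delta>_desc desc_V)
    then show "(\<Sum>i\<in>desc n j. avg A i *\<^sub>R \<Delta> i) - avg A j *\<^sub>R \<Delta> j =
        (\<Sum>i\<in>desc n j. (avg A i - avg A j) *\<^sub>R \<Delta> i)"
      by (simp add: scaleR_sum_right sum_subtractf scaleR_left_diff_distrib)
  qed
  also have "norm \<dots> \<le> (\<Sum>j\<in>desc k r. \<Sum>i\<in>desc n j. L * (measure M (S i) * \<bar>avg A i - avg A j\<bar>))"
  proof (intro sum_norm_le)
    fix j i assume "j \<in> desc k r" "i \<in> desc n j"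
    then have "i \<in> V" using desc_V desc_subset by blast
    from mult_right_mono[OF \<Delta>_bound[OF this] abs_ge_zero[of "avg A i - avg A j"]]
    show "norm ((avg A i - avg A j) *\<^sub>R \<Delta> i) \<le> L * (measure M (S i) * \<bar>avg A i - avg A j\<bar>)"
      by (simp add: mult.commute mult.left_commute)
  qed
  also have "\<dots> = L * osc A k n" by (simp add: osc_def sum_distrib_left)
  finally show ?thesis .
qed

lemma charge_limit:
  assumes A: "A \<in> sets M"
  shows "(\<lambda>k. charge_approx k A) \<longlonglongrightarrow> charge A"
proof -
  have "Cauchy (\<lambda>k. charge_approx k A)"
  proof (rule CauchyI')
    fix e :: real assume "e > 0"
    \<comment> \<open>The denominator is \<open>L + 1\<close> because \<open>L\<close> may be
      0.\<close>
    then have "e / (L + 1) > 0" using L_nonneg by simp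
    from osc_small[OF A this] obtain K where K: "\<And>k n. k \<ge> K \<Longrightarrow> osc A k n < e / (L + 1)"
      by blast
    show "\<exists>K. \<forall>m\<ge>K. \<forall>n>m. dist (charge_approx m A) (charge_approx n A) < e"
    proof (intro exI[of _ K] allI impI)
      fix m n assume "m \<ge> K" "n > m"
      then obtain d where d: "n = m + d" using less_imp_add_positive by blast
      have "norm (charge_approx m A - charge_approx n A) \<le> L * osc A m d"
        using charge_approx_diff[of m d A] by (simp add: d norm_minus_commute)
      also have "\<dots> \<le> L * (e / (L + 1))"
        using K[OF \<open>m \<ge> K\<close>, of d] L_nonneg by (intro mult_left_mono) auto
      also have "\<dots> < e" using \<open>e > 0\<close> L_nonneg by (simp add: field_simps)
      finally show "dist (charge_approx m A) (charge_approx n A) < e" by (simp add: dist_norm)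
    qed
  qed
  then show ?thesis
    unfolding charge_def using Cauchy_convergent_iff convergent_LIMSEQ_iff by blast
qed

text \<open>Each summand has norm at most \<open>L * measure M (A \<inter> S i)\<close>. The
  resulting domination passes to the limit and then supplies bounded variation, absolute continuity
  and the tail estimate for countable additivity.\<close>

lemma charge_approx_bound:
  assumes A: "A \<in> sets M"
  shows "norm (charge_approx k A) \<le> L * measure M A"
proof -
  have "norm (charge_approx k A) \<le> (\<Sum>i\<in>desc k r. L * measure M (A \<inter> S i))"
    unfolding charge_approx_def
  proof (rule sum_norm_le)
    fix i assume "i \<in> desc k r"
    then have i: "i \<in> V" by (rule desc_V)
    show "norm (avg A i *\<^sub>R \<Delta> i) \<le> L * measure M (A \<inter> S i)"
      using mult_left_mono[OF \<Delta>_bound[OF i] avg_nonneg[of A i]] avg_nonneg[of A i]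
      by (simp add: measure_avg[OF i, symmetric] algebra_simps)
  qed
  also have "\<dots> = L * measure M (A \<inter> S r)"
    using measure_splits[OF splits_desc[OF root(1)] A, of k] by (simp add: sum_distrib_left)
  also have "A \<inter> S r = A" using root(2) sets.sets_into_space[OF A] by blast
  finally show ?thesis .
qed

lemma charge_bound:
  assumes A: "A \<in> sets M"
  shows "norm (charge A) \<le> L * measure M A"
  using charge_approx_bound[OF A]
  by (intro LIMSEQ_le_const2[OF tendsto_norm[OF charge_limit[OF A]]]) auto

lemma charge_Un:
  assumes A: "A \<in> sets M" and B: "B \<in> sets M" and "A \<inter> B = {}"
  shows "charge (A \<union> B) = charge A + charge B"
proof -
  have "charge_approx k (A \<union> B) = charge_approx k A + charge_approx k B" for k
    unfolding charge_approx_def sum.distrib[symmetric]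
  proof (intro sum.cong refl)
    fix i assume "i \<in> desc k r"
    then have i: "S i \<in> sets M" by (intro S_sets desc_V)
    have "measure M ((A \<union> B) \<inter> S i) = measure M (A \<inter> S i) + measure M (B \<inter> S i)"
      unfolding Int_Un_distrib2 using assms i by (intro finite_measure_Union) auto
    then show "avg (A \<union> B) i *\<^sub>R \<Delta> i = avg A i *\<^sub>R \<Delta> i + avg B i *\<^sub>R \<Delta> i"
      by (simp add: avg_def add_divide_distrib scaleR_left_distrib)
  qed
  then have "(\<lambda>k. charge_approx k (A \<union> B)) \<longlonglongrightarrow> charge A + charge B"
    using tendsto_add[OF charge_limit[OF A] charge_limit[OF B]] by simp
  moreover have "(\<lambda>k. charge_approx k (A \<union> B)) \<longlonglongrightarrow> charge (A \<union> B)"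
    using A B by (intro charge_limit) auto
  ultimately show ?thesis using LIMSEQ_unique by blast
qed

lemma charge_empty: "charge {} = 0"
  using charge_Un[of "{}" "{}"] by simp

text \<open>From generation \<open>k\<close> on the approximations at \<open>S j\<close> are
  constant: descendants of \<open>j\<close> have conditional average 1, descendants of the other
  nodes of generation \<open>k\<close> have 0. So the limit measure remembers the tree.\<close>

lemma charge_node:
  assumes j: "j \<in> desc k r"
  shows "charge (S j) = \<Delta> j"
proof -
  have jV: "j \<in> V" using j by (rule desc_V)
  have "charge_approx (k + n) (S j) = \<Delta> j" for n
  proof -
    have desc: "i \<in> V" "measure M (S i) \<noteq> 0" "S i \<subseteq> S l" if "l \<in> desc k r" "i \<in> desc n l" for i l
      using that desc_V desc_subset S_pos splits_subset[OF splits_desc] by (metis subsetD less_irrefl)+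
    have "(\<Sum>i\<in>desc n l. avg (S j) i *\<^sub>R \<Delta> i) = (if l = j then \<Delta> j else 0)" if l: "l \<in> desc k r" for l
    proof (cases "l = j")
      case True
      have "avg (S j) i = 1" if "i \<in> desc n j" for i
        using desc(2,3)[OF j that] by (simp add: avg_def Int_absorb1)
      then show ?thesis using True \<Delta>_desc[OF jV, of n] by simp
    next
      case False
      have "avg (S j) i = 0" if "i \<in> desc n l" for i
      proof -
        have "S j \<inter> S l = {}"
          using False l j splits_desc[OF root(1), of k] unfolding splits_def disjoint_family_on_def
          by metis
        then have "S j \<inter> S i = {}" using desc(3)[OF l that] by blast
        then show ?thesis by (simp add: avg_def)
      qed
      then show ?thesis using False by simp
    qed
    then have "charge_approx (k + n) (S j) = (\<Sum>l\<in>desc k r. if l = j then \<Delta> j else 0)"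
      unfolding charge_approx_def sum_desc_add by (intro sum.cong) auto
    also have "\<dots> = \<Delta> j" using j desc_finite[OF root(1), of k] by simp
    finally show ?thesis .
  qed
  moreover have "(\<lambda>n. charge_approx (n + k) (S j)) \<longlonglongrightarrow> charge (S j)"
    using charge_limit[OF S_sets[OF jV]] by (rule LIMSEQ_ignore_initial_segment)
  ultimately show ?thesis
    by (simp add: add.commute LIMSEQ_const_iff)
qed

lemma charge_sum:
  assumes "finite I" "\<And>i. i \<in> I \<Longrightarrow> A i \<in> sets M" "disjoint_family_on A I"
  shows "charge (\<Union>i\<in>I. A i) = (\<Sum>i\<in>I. charge (A i))"
  using assms
proof (induction I rule: finite_induct)
  case (insert x I)
  have "A x \<inter> (\<Union>i\<in>I. A i) = {}"
    using insert.prems(2) insert.hyps(2) by (auto simp: disjoint_family_on_def)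
  then have "charge (A x \<union> (\<Union>i\<in>I. A i)) = charge (A x) + charge (\<Union>i\<in>I. A i)"
    using insert.prems(1) insert.hyps(1) by (intro charge_Un sets.finite_UN) auto
  moreover have "charge (\<Union>i\<in>I. A i) = (\<Sum>i\<in>I. charge (A i))"
    using insert.prems disjoint_family_on_mono[of I "insert x I" A] by (intro insert.IH) auto
  ultimately show ?case
    using insert.hyps by simp
qed (simp add: charge_empty)

text \<open>By finite additivity the error of a partial sum is the charge of the remainder
  \<open>B N\<close>, which is dominated by \<open>L\<close> times a measure tending to 0.\<close>

lemma charge_countably_additive: "countably_additive_vm M charge"
  unfolding countably_additive_vm_def
proof (intro allI impI)
  fix A :: "nat \<Rightarrow> 'w set"
  assume A: "range A \<subseteq> sets M" and disj: "disjoint_family A"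
  have As: "A n \<in> sets M" for n using A by blast
  define B where "B N = (\<Union>n. A n) - (\<Union>n<N. A n)" for N
  have part: "(\<Union>n<N. A n) \<in> sets M" for N using As by (intro sets.finite_UN) auto
  have U: "(\<Union>n. A n) \<in> sets M" using As by blast
  have Bs: "B N \<in> sets M" for N unfolding B_def using part U by blast
  have disjN: "disjoint_family_on A {..<N}" for N
    using disj disjoint_family_on_mono[of "{..<N}" UNIV A] by simp
  have "(\<lambda>N. measure M (\<Union>n. A n) - (\<Sum>n<N. measure M (A n))) \<longlonglongrightarrow>
      measure M (\<Union>n. A n) - measure M (\<Union>n. A n)"
    using finite_measure_UNION[OF A disj] unfolding sums_def by (intro tendsto_intros)
  moreover have "measure M (\<Union>n. A n) - (\<Sum>n<N. measure M (A n)) = measure M (B N)" for N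
  proof -
    have "measure M (\<Union>n<N. A n) = (\<Sum>n<N. measure M (A n))"
      using As disjN by (intro finite_measure_finite_Union) auto
    then show ?thesis
      unfolding B_def using part U by (subst finite_measure_Diff) auto
  qed
  ultimately have lim: "(\<lambda>N. L * measure M (B N)) \<longlonglongrightarrow> 0"
    by (auto intro: tendsto_mult_right_zero)
  have "norm (charge (\<Union>n. A n) - (\<Sum>n<N. charge (A n))) \<le> L * measure M (B N)" for N
  proof -
    have "(\<Union>n<N. A n) \<union> B N = (\<Union>n. A n)" unfolding B_def by blast
    moreover have "(\<Union>n<N. A n) \<inter> B N = {}" unfolding B_def by blast
    ultimately have "charge (\<Union>n. A n) = charge (\<Union>n<N. A n) + charge (B N)"
      using charge_Un[OF part[of N] Bs[of N]] by simp
    then show ?thesis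
      using charge_bound[OF Bs[of N]] charge_sum[OF _ _ disjN[of N]] As by simp
  qed
  then have "(\<lambda>N. charge (\<Union>n. A n) - (\<Sum>n<N. charge (A n))) \<longlonglongrightarrow> 0"
    using lim by (intro Lim_null_comparison[OF _ lim]) auto
  then have "(\<lambda>N. charge (\<Union>n. A n) - (charge (\<Union>n. A n) - (\<Sum>n<N. charge (A n)))) \<longlonglongrightarrow>
      charge (\<Union>n. A n) - 0"
    by (intro tendsto_intros)
  then show "(\<lambda>n. charge (A n)) sums charge (\<Union>n. A n)"
    unfolding sums_def by simp
qed

lemma charge_bounded_variation: "bounded_variation_vm M charge"
  unfolding bounded_variation_vm_def
proof (intro exI[of _ "L * measure M (space M)"] allI impI)
  fix P assume P: "finite P \<and> P \<subseteq> sets M \<and> partition_on (space M) P"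
  have "(\<Sum>A\<in>P. norm (charge A)) \<le> (\<Sum>A\<in>P. L * measure M A)"
    using P by (intro sum_mono charge_bound) auto
  also have "\<dots> = L * measure M (\<Union>A\<in>P. A)"
    using P by (subst finite_measure_finite_Union)
      (auto simp: sum_distrib_left partition_on_def disjoint_def disjoint_family_on_def)
  also have "(\<Union>A\<in>P. A) = space M" using P by (simp add: partition_on_def)
  finally show "(\<Sum>A\<in>P. norm (charge A)) \<le> L * measure M (space M)" .
qed

lemma charge_absolutely_continuous: "absolutely_continuous_vm M charge"
  unfolding absolutely_continuous_vm_def
proof
  fix A assume "A \<in> null_sets M"
  then have "A \<in> sets M" "measure M A = 0" by (auto simp: null_sets_def measure_def)
  then show "charge A = 0" using charge_bound[of A] by simp
qed

end

section \<open>Densities and increments\<close>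

lemma simple_function_norm_diff:
  assumes "simple_function M s" "simple_function M t"
  shows "(\<lambda>\<omega>. norm (s \<omega> - t \<omega>)) \<in> borel_measurable M"
  using simple_function_compose2[OF assms, of "\<lambda>x y. norm (x - y)"]
  by (rule borel_measurable_simple_function)

text \<open>The density need not be measurable in the library's sense, but its distance to a simple
  function agrees almost everywhere with a measurable function; this makes the integral of the
  distance additive.\<close>

lemma norm_diff_AE_measurable:
  fixes f :: "'w \<Rightarrow> 'c::real_normed_vector"
  assumes s: "\<And>i. simple_function M (s i)" and f: "AE \<omega> in M. (\<lambda>i. s i \<omega>) \<longlonglongrightarrow> f \<omega>"
    and t: "simple_function M t"
  obtains h :: "'w \<Rightarrow> real" where "h \<in> borel_measurable M" "AE \<omega> in M. norm (f \<omega> - t \<omega>) = h \<omega>"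
proof
  show "(\<lambda>\<omega>. lim (\<lambda>i. norm (s i \<omega> - t \<omega>))) \<in> borel_measurable M"
    by (intro borel_measurable_lim_metric simple_function_norm_diff s t)
  show "AE \<omega> in M. norm (f \<omega> - t \<omega>) = lim (\<lambda>i. norm (s i \<omega> - t \<omega>))"
    using f
  proof eventually_elim
    case (elim \<omega>)
    then have "(\<lambda>i. norm (s i \<omega> - t \<omega>)) \<longlonglongrightarrow> norm (f \<omega> - t \<omega>)"
      by (intro tendsto_intros)
    then show ?case by (rule limI[symmetric])
  qed
qed

text \<open>For the approximating simple functions \<open>s i\<close> the triangle inequality bounds
  the difference of integrals by the L1 distances of \<open>f\<close> to \<open>s i\<close> and to
  \<open>t\<close>; the first vanishes in the limit.\<close>

lemma strong_bochner_integral_diff_bound: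
  fixes f :: "'w \<Rightarrow> 'c::real_normed_vector"
  assumes f: "has_strong_bochner_integral M f x"
    and t: "Bochner_Integration.simple_bochner_integrable M t"
  shows "ennreal (norm (x - Bochner_Integration.simple_bochner_integral M t)) \<le>
    (\<integral>\<^sup>+\<omega>. ennreal (norm (f \<omega> - t \<omega>)) \<partial>M)"
proof -
  let ?I = "Bochner_Integration.simple_bochner_integral M"
  obtain s where s: "\<And>i. Bochner_Integration.simple_bochner_integrable M (s i)"
    and ae: "AE \<omega> in M. (\<lambda>i. s i \<omega>) \<longlonglongrightarrow> f \<omega>"
    and L1: "(\<lambda>i. \<integral>\<^sup>+\<omega>. ennreal (norm (f \<omega> - s i \<omega>)) \<partial>M) \<longlonglongrightarrow> 0"
    and lim: "(\<lambda>i. ?I (s i)) \<longlonglongrightarrow> x"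
    using f unfolding has_strong_bochner_integral_def by blast
  have sf: "simple_function M (s i)" "simple_function M t" for i
    using s t by (auto elim: Bochner_Integration.simple_bochner_integrable.cases)
  have "ennreal (norm (?I (s i) - ?I t)) \<le>
      (\<integral>\<^sup>+\<omega>. ennreal (norm (f \<omega> - s i \<omega>)) \<partial>M) + (\<integral>\<^sup>+\<omega>. ennreal (norm (f \<omega> - t \<omega>)) \<partial>M)" for i
  proof -
    have int: "Bochner_Integration.simple_bochner_integrable M (\<lambda>\<omega>. s i \<omega> - t \<omega>)"
      using s t by (intro Bochner_Integration.simple_bochner_integrable_compose2[where p="(-)"]) auto
    have int': "Bochner_Integration.simple_bochner_integrable M (\<lambda>\<omega>. norm (s i \<omega> - t \<omega>))"
      using s t
      by (intro Bochner_Integration.simple_bochner_integrable_compose2[where p="\<lambda>a b. norm (a - b)"]) auto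
    obtain h1 where h1: "h1 \<in> borel_measurable M" "AE \<omega> in M. norm (f \<omega> - s i \<omega>) = h1 \<omega>"
      using norm_diff_AE_measurable[OF sf(1) ae sf(1)] by blast
    obtain h2 where h2: "h2 \<in> borel_measurable M" "AE \<omega> in M. norm (f \<omega> - t \<omega>) = h2 \<omega>"
      using norm_diff_AE_measurable[OF sf(1) ae sf(2)] by blast
    have "norm (?I (s i) - ?I t) \<le> ?I (\<lambda>\<omega>. norm (s i \<omega> - t \<omega>))"
      using Bochner_Integration.simple_bochner_integral_norm_bound[OF int]
        Bochner_Integration.simple_bochner_integral_diff[OF s t] by metis
    then have "ennreal (norm (?I (s i) - ?I t)) \<le> (\<integral>\<^sup>+\<omega>. ennreal (norm (s i \<omega> - t \<omega>)) \<partial>M)"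
      using Bochner_Integration.simple_bochner_integral_eq_nn_integral[OF int'] 
      by (metis ennreal_leI norm_ge_zero)
    \<comment> \<open>The measurable representatives \<open>h1\<close> and \<open>h2\<close> replace
      the two norms before the integral is split, since additivity of the integral requires
      measurability.\<close>
    also have "\<dots> \<le> (\<integral>\<^sup>+\<omega>. ennreal (h1 \<omega>) + ennreal (h2 \<omega>) \<partial>M)"
    proof (rule nn_integral_mono_AE)
      show "AE \<omega> in M. ennreal (norm (s i \<omega> - t \<omega>)) \<le> ennreal (h1 \<omega>) + ennreal (h2 \<omega>)"
        using h1(2) h2(2)
      proof eventually_elim
        case (elim \<omega>)
        have "norm (s i \<omega> - t \<omega>) \<le> h1 \<omega> + h2 \<omega>" "0 \<le> h1 \<omega>" "0 \<le> h2 \<omega>"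
          using norm_triangle_ineq4[of "f \<omega> - t \<omega>" "f \<omega> - s i \<omega>"] norm_ge_zero[of "f \<omega> - t \<omega>"]
            norm_ge_zero[of "f \<omega> - s i \<omega>"] elim by simp_all
        then show ?case by (simp flip: ennreal_plus)
      qed
    qed
    also have "\<dots> = (\<integral>\<^sup>+\<omega>. ennreal (h1 \<omega>) \<partial>M) + (\<integral>\<^sup>+\<omega>. ennreal (h2 \<omega>) \<partial>M)"
      using h1(1) h2(1) by (intro nn_integral_add) auto
    also have "(\<integral>\<^sup>+\<omega>. ennreal (h1 \<omega>) \<partial>M) = (\<integral>\<^sup>+\<omega>. ennreal (norm (f \<omega> - s i \<omega>)) \<partial>M)"
      using h1(2) by (intro nn_integral_cong_AE) auto
    also have "(\<integral>\<^sup>+\<omega>. ennreal (h2 \<omega>) \<partial>M) = (\<integral>\<^sup>+\<omega>. ennreal (norm (f \<omega> - t \<omega>)) \<partial>M)"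
      using h2(2) by (intro nn_integral_cong_AE) auto
    finally show ?thesis .
  qed
  moreover have "(\<lambda>i. ennreal (norm (?I (s i) - ?I t))) \<longlonglongrightarrow> ennreal (norm (x - ?I t))"
    using lim by (intro tendsto_intros)
  moreover have "(\<lambda>i. (\<integral>\<^sup>+\<omega>. ennreal (norm (f \<omega> - s i \<omega>)) \<partial>M) + (\<integral>\<^sup>+\<omega>. ennreal (norm (f \<omega> - t \<omega>)) \<partial>M))
      \<longlonglongrightarrow> 0 + (\<integral>\<^sup>+\<omega>. ennreal (norm (f \<omega> - t \<omega>)) \<partial>M)"
    using L1 by (intro tendsto_intros)
  ultimately show ?thesis
    by (metis (no_types, lifting) LIMSEQ_le add_0)
qed

text \<open>The simple integral sums over the values of its integrand. Cutting \<open>s\<close> down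
  to \<open>A\<close> may add the value 0 and may lose values of \<open>s\<close>; in both cases the
  affected terms are zero.\<close>

lemma simple_bochner_integral_restrict:
  fixes s :: "'w \<Rightarrow> 'c::real_vector"
  assumes "finite (s ` space M)" "A \<subseteq> space M"
  shows "Bochner_Integration.simple_bochner_integral M (\<lambda>\<omega>. indicator A \<omega> *\<^sub>R s \<omega>) =
    (\<Sum>y\<in>s ` space M. measure M ({\<omega>\<in>space M. s \<omega> = y} \<inter> A) *\<^sub>R y)"
  unfolding Bochner_Integration.simple_bochner_integral_def
proof (rule sum.mono_neutral_cong)
  let ?t = "\<lambda>\<omega>. indicator A \<omega> *\<^sub>R s \<omega>"
  have sub: "?t ` space M \<subseteq> insert 0 (s ` space M)"
    by (auto simp: indicator_def)
  show "finite (?t ` space M)" using finite_subset[OF sub] assms(1) by simp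
  have *: "{\<omega>\<in>space M. ?t \<omega> = y} = {\<omega>\<in>space M. s \<omega> = y} \<inter> A" if "y \<noteq> 0" for y
    using that assms(2) by (auto simp: indicator_def split: if_splits)
  show "measure M {\<omega>\<in>space M. ?t \<omega> = y} *\<^sub>R y = measure M ({\<omega>\<in>space M. s \<omega> = y} \<inter> A) *\<^sub>R y" for y
    by (cases "y = 0") (simp_all add: *)
  show "measure M {\<omega>\<in>space M. ?t \<omega> = y} *\<^sub>R y = 0" if "y \<in> ?t ` space M - s ` space M" for y
    using that sub by auto
  show "measure M ({\<omega>\<in>space M. s \<omega> = y} \<inter> A) *\<^sub>R y = 0" if "y \<in> s ` space M - ?t ` space M" for y
  proof (cases "y = 0")
    case False
    have "{\<omega>\<in>space M. ?t \<omega> = y} = {}" using that by blast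
    then show ?thesis using *[OF False] by simp
  qed simp
qed (use assms in auto)

section \<open>Vanishing increments in the presence of a density\<close>

context additive_tree
begin

text \<open>\<open>T A\<close> is the integral of \<open>s\<close> over \<open>A\<close>. It is
  linear in the indicators of the level sets of \<open>s\<close>, so the vector-valued increments
  reduce to the scalar ones of finitely many sets. The last argument of \<open>osc\<close> is 1
  because \<open>desc 1 j\<close> is \<open>ch j\<close>.\<close>

lemma osc_simple_function:
  assumes s: "simple_function M s"
  defines "T \<equiv> \<lambda>A. \<Sum>y\<in>s ` space M. measure M ({\<omega>\<in>space M. s \<omega> = y} \<inter> A) *\<^sub>R (y :: 'c)"
  shows "(\<Sum>j\<in>desc k r. \<Sum>i\<in>ch j. norm (T (S i) - (measure M (S i) / measure M (S j)) *\<^sub>R T (S j)))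
    \<le> (\<Sum>y\<in>s ` space M. norm y * osc {\<omega>\<in>space M. s \<omega> = y} k 1)"
proof -
  let ?A = "\<lambda>y. {\<omega>\<in>space M. s \<omega> = y}"
  have "(\<Sum>j\<in>desc k r. \<Sum>i\<in>ch j. norm (T (S i) - (measure M (S i) / measure M (S j)) *\<^sub>R T (S j)))
      \<le> (\<Sum>j\<in>desc k r. \<Sum>i\<in>ch j. \<Sum>y\<in>s ` space M.
          norm y * (measure M (S i) * \<bar>avg (?A y) i - avg (?A y) j\<bar>))"
  proof (intro sum_mono)
    fix j i assume j: "j \<in> desc k r" and i: "i \<in> ch j"
    have V: "j \<in> V" "i \<in> V" using desc_V[OF j] ch_subset i by auto
    have "T (S i) - (measure M (S i) / measure M (S j)) *\<^sub>R T (S j) =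
       (\<Sum>y\<in>s ` space M. (measure M (S i) * (avg (?A y) i - avg (?A y) j)) *\<^sub>R y)"
      unfolding T_def scaleR_sum_right sum_subtractf[symmetric] 
    proof (intro sum.cong refl)
      fix y
      have "measure M (S j) \<noteq> 0" using S_pos[OF V(1)] by simp
      then show "measure M (?A y \<inter> S i) *\<^sub>R y -
          (measure M (S i) / measure M (S j)) *\<^sub>R (measure M (?A y \<inter> S j) *\<^sub>R y) =
          (measure M (S i) * (avg (?A y) i - avg (?A y) j)) *\<^sub>R y"
        unfolding measure_avg[OF V(1), symmetric] measure_avg[OF V(2), symmetric]
        by (simp add: algebra_simps flip: scaleR_left_diff_distrib)
    qed
    also have "norm \<dots> \<le> (\<Sum>y\<in>s ` space M. norm y * (measure M (S i) * \<bar>avg (?A y) i - avg (?A y) j\<bar>))"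
      by (intro sum_norm_le) (simp add: abs_mult mult.commute)
    finally show "norm (T (S i) - (measure M (S i) / measure M (S j)) *\<^sub>R T (S j)) \<le> \<dots>" .
  qed
  also have "\<dots> = (\<Sum>j\<in>desc k r. \<Sum>y\<in>s ` space M. \<Sum>i\<in>ch j. 
          norm y * (measure M (S i) * \<bar>avg (?A y) i - avg (?A y) j\<bar>))"
    by (intro sum.cong refl sum.swap)
  also have "\<dots> = (\<Sum>y\<in>s ` space M. \<Sum>j\<in>desc k r. \<Sum>i\<in>ch j. 
          norm y * (measure M (S i) * \<bar>avg (?A y) i - avg (?A y) j\<bar>))"
    by (rule sum.swap)
  also have "\<dots> = (\<Sum>y\<in>s ` space M. norm y * osc (?A y) k 1)"
    by (simp add: osc_def sum_distrib_left)
  finally show ?thesis .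
qed

text \<open>Replacing the density by a simple function costs its L1 error twice, once for the child
  and once for the parent, as averaging does not increase the L1 norm. Each cost is below
  \<open>\<delta> / 4\<close>, and the simple part contributes at most \<open>\<delta> / 4\<close>
  at a late generation.\<close>

lemma increments_small:
  assumes g: "\<And>A. A \<in> sets M \<Longrightarrow>
      has_strong_bochner_integral M (\<lambda>\<omega>. indicator A \<omega> *\<^sub>R g \<omega>) (charge A)"
    and \<delta>: "\<delta> > 0"
  obtains k where "(\<Sum>j\<in>desc k r. \<Sum>i\<in>ch j.
      norm (\<Delta> i - (measure M (S i) / measure M (S j)) *\<^sub>R \<Delta> j)) < \<delta>"
proof -
  let ?I = "Bochner_Integration.simple_bochner_integral M"
  define f where "f \<omega> = indicator (space M) \<omega> *\<^sub>R g \<omega>" for \<omega>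
  have f: "has_strong_bochner_integral M f (charge (space M))"
    unfolding f_def by (rule g) simp
  obtain s where s: "\<And>i. Bochner_Integration.simple_bochner_integrable M (s i)"
    and ae: "AE \<omega> in M. (\<lambda>i. s i \<omega>) \<longlonglongrightarrow> f \<omega>"
    and L1: "(\<lambda>i. \<integral>\<^sup>+\<omega>. ennreal (norm (f \<omega> - s i \<omega>)) \<partial>M) \<longlonglongrightarrow> 0"
    using f unfolding has_strong_bochner_integral_def by blast
  have sf: "simple_function M (s i)" for i
    using s by (auto elim: Bochner_Integration.simple_bochner_integrable.cases)
  have "ennreal (\<delta> / 4) > 0" using \<delta> by simp
  from order_tendstoD(2)[OF L1 this]
  obtain m where m: "(\<integral>\<^sup>+\<omega>. ennreal (norm (f \<omega> - s m \<omega>)) \<partial>M) < ennreal (\<delta> / 4)"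
    unfolding eventually_sequentially by blast
  define t where "t = s m"
  have t: "simple_function M t" and ti: "Bochner_Integration.simple_bochner_integrable M t"
    unfolding t_def by (rule sf s)+
  have fin: "finite (t ` space M)" using t by (rule simple_functionD(1))
  have lev: "{\<omega>\<in>space M. t \<omega> = y} \<in> sets M" for y
    using simple_functionD(2)[OF t, of "{y}"] by (simp add: vimage_def Int_def conj_commute)
  obtain h where hm: "h \<in> borel_measurable M" and h: "AE \<omega> in M. norm (f \<omega> - t \<omega>) = h \<omega>"
    using norm_diff_AE_measurable[OF sf ae t] by blast
  \<comment> \<open>\<open>N\<close> is the approximation error as a measure:
    \<open>measure N A\<close> bounds the error of \<open>T\<close> on \<open>A\<close>, and its
    additivity allows the errors of a whole generation to be summed.\<close>
  define N where "N = density M (\<lambda>\<omega>. ennreal (h \<omega>))"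
  have setsN: "sets N = sets M" and spaceN: "space N = space M" by (simp_all add: N_def)
  have "emeasure N (space M) = (\<integral>\<^sup>+\<omega>. ennreal (h \<omega>) \<partial>M)"
    unfolding N_def using hm by (subst emeasure_density) (auto intro!: nn_integral_cong)
  also have "\<dots> = (\<integral>\<^sup>+\<omega>. ennreal (norm (f \<omega> - t \<omega>)) \<partial>M)"
    using h by (intro nn_integral_cong_AE) auto
  finally have Nsp: "emeasure N (space M) < ennreal (\<delta> / 4)" using m by (simp add: t_def)
  interpret N: finite_measure N
    by (rule finite_measureI) (use Nsp spaceN in auto)
  have Ntot: "measure N (space M) < \<delta> / 4"
    using Nsp \<delta> by (simp add: N.emeasure_eq_measure ennreal_less_iff)
  have Nsum: "(\<Sum>i\<in>desc k r. measure N (S i)) = measure N (space M)" for k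
  proof -
    have "measure N (\<Union>i\<in>desc k r. S i) = (\<Sum>i\<in>desc k r. measure N (S i))"
      using splits_desc[OF root(1), of k] S_sets
      by (intro N.finite_measure_finite_Union) (auto simp: splits_def setsN)
    then show ?thesis
      using splits_desc[OF root(1), of k] root(2) by (simp add: splits_def)
  qed
  define T where "T A = (\<Sum>y\<in>t ` space M. measure M ({\<omega>\<in>space M. t \<omega> = y} \<inter> A) *\<^sub>R y)" for A
  have approx: "norm (charge A - T A) \<le> measure N A" if A: "A \<in> sets M" for A
  proof -
    have AM: "A \<subseteq> space M" using A by (rule sets.sets_into_space)
    have "simple_function M (\<lambda>\<omega>. indicator A \<omega> *\<^sub>R t \<omega>)"
      using simple_function_compose2[OF simple_function_indicator[OF A, where 'b=real] t, of scaleR] .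
    then have it: "Bochner_Integration.simple_bochner_integrable M (\<lambda>\<omega>. indicator A \<omega> *\<^sub>R t \<omega>)"
      by (rule Bochner_Integration.simple_bochner_integrable.intros) simp
    have "ennreal (norm (charge A - T A)) \<le>
        (\<integral>\<^sup>+\<omega>. ennreal (norm (indicator A \<omega> *\<^sub>R g \<omega> - indicator A \<omega> *\<^sub>R t \<omega>)) \<partial>M)"
      using strong_bochner_integral_diff_bound[OF g[OF A] it]
      by (simp add: simple_bochner_integral_restrict[OF fin AM] T_def)
    also have "\<dots> = (\<integral>\<^sup>+\<omega>. ennreal (h \<omega>) * indicator A \<omega> \<partial>M)"
    proof (rule nn_integral_cong_AE)
      show "AE \<omega> in M. ennreal (norm (indicator A \<omega> *\<^sub>R g \<omega> - indicator A \<omega> *\<^sub>R t \<omega>)) =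
          ennreal (h \<omega>) * indicator A \<omega>"
        using h AE_space
        by eventually_elim (auto simp: f_def indicator_def)
    qed
    also have "\<dots> = emeasure N A"
      unfolding N_def using hm A by (subst emeasure_density) auto
    finally show ?thesis by (simp add: N.emeasure_eq_measure)
  qed
  \<comment> \<open>Chosen so that \<open>w\<close> times the sum of the norms of the values of
    \<open>t\<close> is at most \<open>\<delta> / 4\<close>; the summand 1 keeps the denominator
    positive.\<close>
  define w where "w = \<delta> / (4 * (1 + (\<Sum>y\<in>t ` space M. norm y)))"
  have nn: "0 \<le> (\<Sum>y\<in>t ` space M. norm y)" by (intro sum_nonneg) simp
  then have w: "w > 0" unfolding w_def using \<delta> by simp
  have "\<forall>y\<in>t ` space M. \<forall>\<^sub>F k in sequentially. osc {\<omega>\<in>space M. t \<omega> = y} k 1 < w"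
    using osc_small[OF lev w] unfolding eventually_sequentially by blast
  then have "\<forall>\<^sub>F k in sequentially. \<forall>y\<in>t ` space M. osc {\<omega>\<in>space M. t \<omega> = y} k 1 < w"
    using fin by (intro eventually_ball_finite)
  then obtain k where k: "\<And>y. y \<in> t ` space M \<Longrightarrow> osc {\<omega>\<in>space M. t \<omega> = y} k 1 < w"
    unfolding eventually_sequentially by blast
  have "(\<Sum>j\<in>desc k r. \<Sum>i\<in>ch j. norm (\<Delta> i - (measure M (S i) / measure M (S j)) *\<^sub>R \<Delta> j)) \<le>
      (\<Sum>j\<in>desc k r. \<Sum>i\<in>ch j. measure N (S i) + measure M (S i) * (measure N (S j) / measure M (S j)) +
          norm (T (S i) - (measure M (S i) / measure M (S j)) *\<^sub>R T (S j)))"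
  proof (intro sum_mono)
    fix j i assume j: "j \<in> desc k r" and i: "i \<in> ch j"
    have V: "j \<in> V" "i \<in> V" using desc_V[OF j] ch_subset i by auto
    \<comment> \<open>Both nodes belong to a generation of the root, so \<open>charge_node\<close>
      identifies their charges with \<open>\<Delta>\<close>.\<close>
    have "i \<in> desc (Suc k) r" using i j by auto
    then have D: "charge (S i) = \<Delta> i" "charge (S j) = \<Delta> j" using charge_node j by blast+
    define q where "q = measure M (S i) / measure M (S j)"
    have q: "0 \<le> q" by (simp add: q_def)
    have "norm (\<Delta> i - q *\<^sub>R \<Delta> j) =
        norm ((\<Delta> i - T (S i)) - q *\<^sub>R (\<Delta> j - T (S j)) + (T (S i) - q *\<^sub>R T (S j)))"
      by (simp add: algebra_simps)
    also have "\<dots> \<le> norm (\<Delta> i - T (S i)) + norm (q *\<^sub>R (\<Delta> j - T (S j))) + norm (T (S i) - q *\<^sub>R T (S j))"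
      by (intro norm_triangle_mono norm_triangle_ineq4 order_refl)
    also have "\<dots> \<le> measure N (S i) + q * measure N (S j) + norm (T (S i) - q *\<^sub>R T (S j))"
      using approx[OF S_sets[OF V(1)]] approx[OF S_sets[OF V(2)]] q
      by (simp add: D add_mono mult_left_mono)
    finally show "norm (\<Delta> i - (measure M (S i) / measure M (S j)) *\<^sub>R \<Delta> j) \<le>
        measure N (S i) + measure M (S i) * (measure N (S j) / measure M (S j)) +
        norm (T (S i) - (measure M (S i) / measure M (S j)) *\<^sub>R T (S j))"
      by (simp add: q_def)
  qed
  also have "\<dots> = (\<Sum>j\<in>desc k r. \<Sum>i\<in>ch j. measure N (S i)) +
      (\<Sum>j\<in>desc k r. \<Sum>i\<in>ch j. measure M (S i) * (measure N (S j) / measure M (S j))) +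
      (\<Sum>j\<in>desc k r. \<Sum>i\<in>ch j. norm (T (S i) - (measure M (S i) / measure M (S j)) *\<^sub>R T (S j)))"
    by (simp add: sum.distrib)
  also have "(\<Sum>j\<in>desc k r. \<Sum>i\<in>ch j. measure N (S i)) = measure N (space M)"
    using sum_desc_add[of "\<lambda>i. measure N (S i)" k 1] Nsum[of "k + 1"] by simp
  \<comment> \<open>The error of a parent is spread over its children in proportion to their
    measure, so it is recovered by summing.\<close>
  also have "(\<Sum>j\<in>desc k r. \<Sum>i\<in>ch j. measure M (S i) * (measure N (S j) / measure M (S j))) =
      (\<Sum>j\<in>desc k r. measure N (S j))"
  proof (intro sum.cong refl)
    fix j assume "j \<in> desc k r"
    then have j: "j \<in> V" by (rule desc_V)
    then show "(\<Sum>i\<in>ch j. measure M (S i) * (measure N (S j) / measure M (S j))) = measure N (S j)"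
      using measure_splits'[OF splits_ch[OF j] j] S_pos[OF j] 
      by (simp flip: sum_distrib_right sum_divide_distrib)
  qed
  also have "\<dots> = measure N (space M)" by (rule Nsum)
  also have "(\<Sum>j\<in>desc k r. \<Sum>i\<in>ch j. norm (T (S i) - (measure M (S i) / measure M (S j)) *\<^sub>R T (S j)))
      \<le> (\<Sum>y\<in>t ` space M. norm y * osc {\<omega>\<in>space M. t \<omega> = y} k 1)"
    unfolding T_def by (rule osc_simple_function[OF t])
  also have "\<dots> \<le> (\<Sum>y\<in>t ` space M. norm y * w)"
    using k by (intro sum_mono mult_left_mono) (auto intro: less_imp_le)
  also have "\<dots> = (\<Sum>y\<in>t ` space M. norm y) * w" by (simp add: sum_distrib_right)
  also have "\<dots> \<le> \<delta> / 4" using nn \<delta> by (simp add: w_def field_simps)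
  finally show ?thesis using Ntot \<delta> by (intro that[of k]) simp
qed

end

text \<open>Summed over a generation, \<open>sep\<close> bounds the L1 norm of the increment below
  by \<open>\<kappa> * measure M (S r)\<close>, the same for all generations. A density of
  \<open>charge\<close> would make some increment smaller.\<close>

lemma RNP_no_separated_tree:
  fixes M :: "real measure" and \<Delta> :: "'n \<Rightarrow> 'c::banach"
  assumes tree: "additive_tree M V S ch \<Delta> L r" and RNP: "radon_nikodym_property TYPE('c)"
    and \<kappa>: "\<kappa> > 0"
    and sep: "\<And>j. j \<in> V \<Longrightarrow> \<kappa> * measure M (S j) \<le>
      (\<Sum>i\<in>ch j. norm (\<Delta> i - (measure M (S i) / measure M (S j)) *\<^sub>R \<Delta> j))"
  shows False
proof -
  interpret additive_tree M V S ch \<Delta> L r by fact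
  obtain g where g: "\<And>A. A \<in> sets M \<Longrightarrow>
      has_strong_bochner_integral M (\<lambda>\<omega>. indicator A \<omega> *\<^sub>R g \<omega>) (charge A)"
    using RNP finite_measure_axioms charge_countably_additive charge_bounded_variation
      charge_absolutely_continuous unfolding radon_nikodym_property_def by blast
  have "\<kappa> * measure M (S r) > 0" using \<kappa> S_pos[OF root(1)] by simp
  from increments_small[OF g this] obtain k where
    k: "(\<Sum>j\<in>desc k r. \<Sum>i\<in>ch j. norm (\<Delta> i - (measure M (S i) / measure M (S j)) *\<^sub>R \<Delta> j))
      < \<kappa> * measure M (S r)" by blast
  have "\<kappa> * measure M (S r) = (\<Sum>j\<in>desc k r. \<kappa> * measure M (S j))"
    using measure_splits'[OF splits_desc[OF root(1)] root(1), of k] by (simp add: sum_distrib_left)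
  also have "\<dots> \<le> (\<Sum>j\<in>desc k r. \<Sum>i\<in>ch j. norm (\<Delta> i - (measure M (S i) / measure M (S j)) *\<^sub>R \<Delta> j))"
    by (intro sum_mono sep desc_V)
  finally show False using k by simp
qed

section \<open>Refining geodesics\<close>

text \<open>The upper bound gives a Lipschitz extension from the dense range of
  \<open>\<iota>\<close>. The lower bound is a closed condition on pairs of points, so it carries
  over from a dense set of pairs.\<close>

lemma bilipschitz_extend_completion:
  fixes \<iota> :: "'a::metric_space \<Rightarrow> 'b::complete_space" and f :: "'a \<Rightarrow> 'c::banach"
  assumes \<iota>: "is_completion \<iota>" and f: "bilipschitz_embedding f"
  obtains g :: "'b \<Rightarrow> 'c" where "bilipschitz_embedding g"
proof -
  obtain l L where l: "0 < l" "l \<le> L"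
    and lo: "\<And>x y. l * dist x y \<le> norm (f x - f y)"
    and up: "\<And>x y. norm (f x - f y) \<le> L * dist x y"
    using f unfolding bilipschitz_embedding_def by blast
  have iso: "dist (\<iota> x) (\<iota> y) = dist x y" for x y using \<iota> by (simp add: is_completion_def)
  have dense: "closure (range \<iota>) = UNIV" using \<iota> by (simp add: is_completion_def)
  have "inj \<iota>" by (rule injI) (metis iso dist_eq_0_iff)
  then have inv: "inv \<iota> (\<iota> x) = x" for x by simp
  have "L-lipschitz_on (range \<iota>) (\<lambda>y. f (inv \<iota> y))"
    using l up by (intro lipschitz_onI) (auto simp: inv iso dist_norm)
  from lipschitz_extend_closure[OF this] obtain g where
    g: "L-lipschitz_on UNIV g" and ext: "\<And>x. g (\<iota> x) = f x"
    unfolding dense by (auto simp: inv)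
  have cont: "continuous_on UNIV g" using g by (rule lipschitz_on_continuous_on)
  have cont': "continuous_on UNIV (\<lambda>p. g (fst p))" "continuous_on UNIV (\<lambda>p. g (snd p))"
    by (intro continuous_on_compose2[OF cont] continuous_intros; simp)+
  have "closed {p. l * dist (fst p) (snd p) \<le> norm (g (fst p) - g (snd p))}"
    by (intro closed_Collect_le continuous_intros cont')
  then have "closure (range \<iota> \<times> range \<iota>) \<subseteq> {p. l * dist (fst p) (snd p) \<le> norm (g (fst p) - g (snd p))}"
    using lo by (intro closure_minimal) (auto simp: iso ext)
  then have "l * dist x y \<le> norm (g x - g y)" for x y
    unfolding closure_Times dense UNIV_Times_UNIV by (drule_tac subsetD[OF _ UNIV_I[of "(x, y)"]]) simp
  moreover have "norm (g x - g y) \<le> L * dist x y" for x y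
    using lipschitz_onD[OF g, of x y] by (simp add: dist_norm)
  ultimately show ?thesis
    using l by (intro that[of g]) (unfold bilipschitz_embedding_def, blast)
qed

section \<open>Ordered points on geodesics\<close>

lemma listed_in_order_subset: "listed_in_order u v S ps \<Longrightarrow> set ps \<subseteq> S"
  unfolding listed_in_order_def geodesic_param_def by (metis image_mono set_map)

text \<open>Distances are differences of parameters, and the parameters are monotone in one of the
  two directions.\<close>

lemma listed_in_order_dist:
  assumes "listed_in_order u v S ps" and ijk: "i \<le> j" "j \<le> k" "k < length ps"
  shows "dist (ps ! i) (ps ! k) = dist (ps ! i) (ps ! j) + dist (ps ! j) (ps ! k)"
proof -
  obtain \<gamma> ts where \<gamma>: "geodesic_param u v \<gamma> S" and ts: "set ts \<subseteq> {0..dist u v}"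
    and sorted: "sorted ts \<or> sorted (rev ts)" and ps: "ps = map \<gamma> ts"
    using assms(1) unfolding listed_in_order_def by blast
  have len: "k < length ts" using ijk ps by simp
  have "dist (\<gamma> (ts ! a)) (\<gamma> (ts ! b)) = \<bar>ts ! a - ts ! b\<bar>" if "a \<le> k" "b \<le> k" for a b
  proof -
    have "ts ! a \<in> {0..dist u v}" "ts ! b \<in> {0..dist u v}"
      using subsetD[OF ts nth_mem] that len by auto
    then show ?thesis using \<gamma> unfolding geodesic_param_def by blast
  qed
  then have "dist (ps ! a) (ps ! b) = \<bar>ts ! a - ts ! b\<bar>" if "a \<le> k" "b \<le> k" for a b
    using that len ps by simp
  moreover have "(ts ! i \<le> ts ! j \<and> ts ! j \<le> ts ! k) \<or> (ts ! i \<ge> ts ! j \<and> ts ! j \<ge> ts ! k)"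
    using sorted
  proof
    assume "sorted ts"
    then show ?thesis using ijk len by (auto intro: sorted_nth_mono)
  next
    assume "sorted (rev ts)"
    then show ?thesis using ijk len by (auto intro: sorted_rev_nth_mono)
  qed
  ultimately show ?thesis using ijk by auto
qed

text \<open>The entries of \<open>interleave\<close> by position. The points \<open>z\<close> are
  numbered from 1, whence the \<open>Suc\<close> at odd positions.\<close>

definition zigzag :: "(nat \<Rightarrow> 'b) \<Rightarrow> (nat \<Rightarrow> 'b) \<Rightarrow> nat \<Rightarrow> 'b" where
  "zigzag w z m = (if even m then w (m div 2) else z (Suc (m div 2)))"

lemma interleave_eq_map: "interleave n w z = map (zigzag w z) [0..<Suc (2 * n)]"
proof (induction n)
  case (Suc n)
  have "interleave (Suc n) w z = interleave n w z @ [z (Suc n), w (Suc n)]"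
    by (simp add: interleave_def)
  also have "\<dots> = map (zigzag w z) [0..<Suc (2 * Suc n)]"
    unfolding Suc by (simp add: zigzag_def)
  finally show ?case .
qed (simp add: interleave_def zigzag_def)

lemma listed_in_order_zigzag:
  assumes "listed_in_order u v S (interleave n w z)"
  shows "m \<le> 2 * n \<Longrightarrow> zigzag w z m \<in> S"
    and "i \<le> j \<Longrightarrow> j \<le> k \<Longrightarrow> k \<le> 2 * n \<Longrightarrow> dist (zigzag w z i) (zigzag w z k) =
      dist (zigzag w z i) (zigzag w z j) + dist (zigzag w z j) (zigzag w z k)"
proof -
  show "zigzag w z m \<in> S" if "m \<le> 2 * n"
  proof -
    have "m \<in> set [0..<Suc (2 * n)]" using that by (simp del: upt_Suc)
    then show ?thesis
      using listed_in_order_subset[OF assms] unfolding interleave_eq_map set_map by blast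
  qed
  show "dist (zigzag w z i) (zigzag w z k) =
      dist (zigzag w z i) (zigzag w z j) + dist (zigzag w z j) (zigzag w z k)"
    if "i \<le> j" "j \<le> k" "k \<le> 2 * n"
    using listed_in_order_dist[OF assms that(1,2)] that unfolding interleave_eq_map
    by (simp del: upt_Suc)
qed

lemma sum_pairs: "(\<Sum>m<2 * n. h m) = (\<Sum>k<n. h (2 * k) + h (Suc (2 * k)))"
  for h :: "nat \<Rightarrow> 'd::comm_monoid_add"
  by (induction n) (simp_all add: add.assoc)

text \<open>\<open>z i\<close> and its twin are equally far from \<open>w (i - 1)\<close>, so
  \<open>f (z i) - f (z' i)\<close> is the difference of their deviations from slope
  \<open>e\<close>. The larger deviation is therefore at least half of
  \<open>l * dist (z i) (z' i)\<close>, and the chain through the points of larger deviation has the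
  required properties.\<close>

lemma thick_refinement:
  fixes f :: "'b::metric_space \<Rightarrow> 'c::real_normed_vector" and w z z' :: "nat \<Rightarrow> 'b"
  assumes z: "T \<in> marked" "listed_in_order u v T (interleave n w z)"
    and z': "T' \<in> marked" "listed_in_order u v T' (interleave n w z')"
    and eq: "\<And>i. i \<in> {1..n} \<Longrightarrow> dist (w (i - 1)) (z i) = dist (w (i - 1)) (z' i)"
    and lo: "\<And>x y. l * dist x y \<le> norm (f x - f y)"
  obtains x where "x 0 = w 0" "x (2 * n) = w n"
    "\<forall>m<2 * n. \<exists>T\<in>marked. x m \<in> T \<and> x (Suc m) \<in> T"
    "(\<Sum>m<2 * n. dist (x m) (x (Suc m))) = dist (w 0) (w n)"
    "l / 2 * (\<Sum>i=1..n. dist (z i) (z' i)) \<le>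
      (\<Sum>m<2 * n. norm (f (x (Suc m)) - f (x m) - dist (x m) (x (Suc m)) *\<^sub>R e))"
proof -
  define dev where "dev p q = norm (f q - f p - dist p q *\<^sub>R e)" for p q
  define y where "y i = (if dev (w (i - 1)) (z i) \<ge> dev (w (i - 1)) (z' i) then z i else z' i)" for i
  \<comment> \<open>The two chains share the points \<open>w\<close>, so every edge of the mixed
    chain is an edge of one of them. Membership in marked geodesics and additivity of distances are
    inherited edge by edge.\<close>
  have local: "(zigzag w y m = zigzag w z m \<and> zigzag w y (Suc m) = zigzag w z (Suc m)) \<or>
      (zigzag w y m = zigzag w z' m \<and> zigzag w y (Suc m) = zigzag w z' (Suc m))" for m
    by (cases "even m") (auto simp: zigzag_def y_def)
  have base: "zigzag w a 0 = w 0" "zigzag w a (2 * n) = w n" for a by (simp_all add: zigzag_def)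
  show ?thesis
  proof
    show "zigzag w y 0 = w 0" "zigzag w y (2 * n) = w n" by (rule base)+
    show "\<forall>m<2 * n. \<exists>T\<in>marked. zigzag w y m \<in> T \<and> zigzag w y (Suc m) \<in> T"
      using local listed_in_order_zigzag(1)[OF z(2)] listed_in_order_zigzag(1)[OF z'(2)] z z'
      by (metis Suc_leI less_imp_le)
    \<comment> \<open>The mixed chain need not lie on one geodesic; its length is found by measuring
      from \<open>w 0\<close>, which both chains have in common.\<close>
    have "(\<Sum>m<k. dist (zigzag w y m) (zigzag w y (Suc m))) = dist (w 0) (zigzag w y k)"
      if "k \<le> 2 * n" for k
      using that
    proof (induction k)
      case (Suc k)
      have "dist (w 0) (zigzag w y (Suc k)) =
          dist (w 0) (zigzag w y k) + dist (zigzag w y k) (zigzag w y (Suc k))"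
        using local[of k] listed_in_order_zigzag(2)[OF z(2), of 0 k "Suc k"]
          listed_in_order_zigzag(2)[OF z'(2), of 0 k "Suc k"] Suc.prems unfolding base by auto
      then show ?case using Suc by simp
    qed (simp add: base)
    from this[of "2 * n"] show "(\<Sum>m<2 * n. dist (zigzag w y m) (zigzag w y (Suc m))) = dist (w 0) (w n)"
      by (simp add: base)
    have "l / 2 * (\<Sum>i=1..n. dist (z i) (z' i)) = (\<Sum>k<n. l / 2 * dist (z (Suc k)) (z' (Suc k)))"
      by (simp add: sum.atLeast1_atMost_eq sum_distrib_left)
    also have "\<dots> \<le> (\<Sum>k<n. dev (zigzag w y (2 * k)) (zigzag w y (Suc (2 * k)))
        + dev (zigzag w y (Suc (2 * k))) (zigzag w y (Suc (Suc (2 * k)))))"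
    proof (intro sum_mono)
      fix k assume "k \<in> {..<n}"
      then have d: "dist (w k) (z (Suc k)) = dist (w k) (z' (Suc k))" using eq[of "Suc k"] by simp
      have "l * dist (z (Suc k)) (z' (Suc k)) \<le> norm (f (z (Suc k)) - f (z' (Suc k)))" by (rule lo)
      also have "f (z (Suc k)) - f (z' (Suc k)) = (f (z (Suc k)) - f (w k) - dist (w k) (z (Suc k)) *\<^sub>R e)
          - (f (z' (Suc k)) - f (w k) - dist (w k) (z' (Suc k)) *\<^sub>R e)"
        by (simp add: d)
      also have "norm \<dots> \<le> dev (w k) (z (Suc k)) + dev (w k) (z' (Suc k))"
        unfolding dev_def by (rule norm_triangle_ineq4)
      also have "\<dots> \<le> 2 * dev (w k) (y (Suc k))" by (simp add: y_def)
      also have "dev (w k) (y (Suc k)) = dev (zigzag w y (2 * k)) (zigzag w y (Suc (2 * k)))"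
        by (simp add: zigzag_def)
      finally have "l / 2 * dist (z (Suc k)) (z' (Suc k)) \<le> dev (zigzag w y (2 * k)) (zigzag w y (Suc (2 * k)))"
        by simp
      \<comment> \<open>Only the edges from \<open>w k\<close> to \<open>y (Suc k)\<close> are used
        for the lower bound; the return edges merely contribute nonnegative terms.\<close>
      moreover have "0 \<le> dev (zigzag w y (Suc (2 * k))) (zigzag w y (Suc (Suc (2 * k))))"
        by (simp add: dev_def)
      ultimately show "l / 2 * dist (z (Suc k)) (z' (Suc k)) \<le>
          dev (zigzag w y (2 * k)) (zigzag w y (Suc (2 * k)))
        + dev (zigzag w y (Suc (2 * k))) (zigzag w y (Suc (Suc (2 * k))))" by linarith
    qed
    finally show "l / 2 * (\<Sum>i=1..n. dist (z i) (z' i)) \<le> (\<Sum>m<2 * n.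
        norm (f (zigzag w y (Suc m)) - f (zigzag w y m) - dist (zigzag w y m) (zigzag w y (Suc m)) *\<^sub>R e))"
      unfolding sum_pairs dev_def .
  qed
qed

section \<open>Tiling intervals by segments\<close>

lemma UN_atLeastLessThan_mono:
  fixes t :: "nat \<Rightarrow> 'd::linorder"
  assumes "mono t"
  shows "(\<Union>m<n. {t m..<t (Suc m)}) = {t 0..<t n}"
proof (induction n)
  case (Suc n)
  have "t 0 \<le> t n" "t n \<le> t (Suc n)" using assms by (auto intro: monoD)
  then show ?case
    using Suc ivl_disj_un(17)[of "t 0" "t n" "t (Suc n)"] by (simp add: lessThan_Suc Un_commute)
qed simp

text \<open>A segment \<open>(p, q, s)\<close> is a pair of points together with the left end point of an interval
  of length \<open>dist p q\<close>.\<close>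

fun seg_ivl :: "'b::metric_space \<times> 'b \<times> real \<Rightarrow> real set" where
  "seg_ivl (p, q, s) = {s..<s + dist p q}"

fun seg_len :: "'b::metric_space \<times> 'b \<times> real \<Rightarrow> real" where
  "seg_len (p, q, s) = dist p q"

fun seg_diff :: "('b \<Rightarrow> 'c::real_normed_vector) \<Rightarrow> 'b \<times> 'b \<times> real \<Rightarrow> 'c" where
  "seg_diff f (p, q, s) = f q - f p"

text \<open>The partial sums of the edge lengths, shifted by \<open>s\<close>, cut the interval into
  half-open pieces, one per edge. Degenerate edges are discarded so that all pieces have positive
  length; their terms in the sums are zero.\<close>

lemma subdivide_segment:
  fixes f :: "'b::metric_space \<Rightarrow> 'c::real_normed_vector" and x :: "nat \<Rightarrow> 'b" and e :: 'c
  assumes len: "(\<Sum>m<N. dist (x m) (x (Suc m))) = dist (x 0) (x N)"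
  obtains C where "finite C"
    "\<forall>j\<in>C. \<exists>m<N. \<exists>t. j = (x m, x (Suc m), t) \<and> x m \<noteq> x (Suc m)"
    "disjoint_family_on seg_ivl C" "(\<Union>i\<in>C. seg_ivl i) = {s..<s + dist (x 0) (x N)}"
    "(\<Sum>i\<in>C. seg_diff f i) = f (x N) - f (x 0)"
    "(\<Sum>i\<in>C. norm (seg_diff f i - seg_len i *\<^sub>R e)) =
      (\<Sum>m<N. norm (f (x (Suc m)) - f (x m) - dist (x m) (x (Suc m)) *\<^sub>R e))"
proof -
  define t where "t n = s + (\<Sum>m<n. dist (x m) (x (Suc m)))" for n
  define I where "I = {m. m < N \<and> x m \<noteq> x (Suc m)}"
  define node where "node m = (x m, x (Suc m), t m)" for m
  have "mono t" by (intro incseq_SucI) (simp add: t_def)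
  have ivl: "seg_ivl (node m) = {t m..<t (Suc m)}" for m by (simp add: node_def t_def add.assoc)
  have I: "finite I" "I \<subseteq> {..<N}" by (auto simp: I_def)
  have pos: "t m < t (Suc m)" if "m \<in> I" for m using that by (simp add: I_def t_def)
  have disj: "seg_ivl (node m) \<inter> seg_ivl (node m') = {}" if "m < m'" for m m'
    using monoD[OF \<open>mono t\<close>, of "Suc m" m'] that unfolding ivl by auto
  then have disj': "seg_ivl (node m) \<inter> seg_ivl (node m') = {}" if "m \<noteq> m'" for m m'
    using that by (metis inf_commute linorder_neqE_nat)
  \<comment> \<open>Pieces of different edges are disjoint and, on \<open>I\<close>, nonempty, so
    equal nodes come from equal edges.\<close>
  have inj: "inj_on node I"
  proof (rule inj_onI, rule ccontr)
    fix m m' assume "m \<in> I" "m' \<in> I" "node m = node m'" "m \<noteq> m'"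
    then have "seg_ivl (node m') = {}" using disj'[of m m'] by simp
    then show False using pos[OF \<open>m' \<in> I\<close>] unfolding ivl by simp
  qed
  have sumI: "(\<Sum>i\<in>node ` I. h i) = (\<Sum>m<N. h (node m))"
    if "\<And>m. x m = x (Suc m) \<Longrightarrow> h (node m) = 0" for h :: "_ \<Rightarrow> 'd::comm_monoid_add"
    unfolding sum.reindex[OF inj] o_def using I that
    by (intro sum.mono_neutral_left) (auto simp: I_def)
  show ?thesis
  proof
    show "finite (node ` I)" using I by simp
    show "\<forall>j\<in>node ` I. \<exists>m<N. \<exists>t. j = (x m, x (Suc m), t) \<and> x m \<noteq> x (Suc m)"
      by (auto simp: I_def node_def)
    show "disjoint_family_on seg_ivl (node ` I)"
      unfolding disjoint_family_on_def using disj' by (metis imageE)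
    have "(\<Union>i\<in>node ` I. seg_ivl i) = (\<Union>m<N. seg_ivl (node m))"
      by (auto simp: I_def node_def)
    also have "\<dots> = {t 0..<t N}" unfolding ivl by (rule UN_atLeastLessThan_mono[OF \<open>mono t\<close>])
    also have "\<dots> = {s..<s + dist (x 0) (x N)}" by (simp add: t_def len)
    finally show "(\<Union>i\<in>node ` I. seg_ivl i) = {s..<s + dist (x 0) (x N)}" .
    have "(\<Sum>i\<in>node ` I. seg_diff f i) = (\<Sum>m<N. f (x (Suc m)) - f (x m))"
      by (subst sumI) (simp_all add: node_def)
    then show "(\<Sum>i\<in>node ` I. seg_diff f i) = f (x N) - f (x 0)"
      using sum_lessThan_telescope[of "\<lambda>m. f (x m)" N] by simp
    show "(\<Sum>i\<in>node ` I. norm (seg_diff f i - seg_len i *\<^sub>R e)) =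
      (\<Sum>m<N. norm (f (x (Suc m)) - f (x m) - dist (x m) (x (Suc m)) *\<^sub>R e))"
      by (subst sumI) (simp_all add: node_def)
  qed
qed

section \<open>The segment tree of a bilipschitz embedding\<close>

lemma geodesic_same_endpoints: "is_geodesic u u S \<Longrightarrow> S = {u}"
  unfolding is_geodesic_def geodesic_param_def by auto

theorem theorem4p1:
  fixes \<iota> :: "'a::metric_space \<Rightarrow> 'b::complete_space"
    and u v :: 'a
    and marked :: "'b set set"
    and c :: real
  assumes completion: "is_completion \<iota>"
    and marked_geodesics: "\<forall>S\<in>marked. is_geodesic (\<iota> u) (\<iota> v) S"
    and infinitely_many: "infinite marked"
    and c_pos: "c > 0"
    and thick: "\<forall>S\<in>marked. \<forall>u0\<in>S. \<forall>v0\<in>S.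
      \<exists>(n::nat) (w :: nat \<Rightarrow> 'b) (z :: nat \<Rightarrow> 'b) (z' :: nat \<Rightarrow> 'b).
        n \<ge> 1 \<and> w 0 = u0 \<and> w n = v0 \<and>
        (\<exists>T\<in>marked. listed_in_order (\<iota> u) (\<iota> v) T (map w [0..<Suc n])) \<and>
        (\<exists>T\<in>marked. listed_in_order (\<iota> u) (\<iota> v) T (interleave n w z)) \<and>
        (\<exists>T\<in>marked. listed_in_order (\<iota> u) (\<iota> v) T (interleave n w z')) \<and>
        (\<forall>i\<in>{1..n}. dist (w i) (z i) = dist (w i) (z' i) \<and>
                     dist (w (i - 1)) (z i) = dist (w (i - 1)) (z' i)) \<and>
        (\<Sum>i=1..n. dist (z i) (z' i)) \<ge> c * dist u0 v0"
    and RNP: "radon_nikodym_property TYPE('c::banach)"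
  shows "\<not> (\<exists>f :: 'a \<Rightarrow> 'c. bilipschitz_embedding f)"
proof
  assume "\<exists>f :: 'a \<Rightarrow> 'c. bilipschitz_embedding f"
  \<comment> \<open>From here on \<open>f\<close> is the embedding of the completion, where the
    geodesics live.\<close>
  then obtain f :: "'b \<Rightarrow> 'c" where "bilipschitz_embedding f"
    using bilipschitz_extend_completion[OF completion] by blast
  then obtain l L where l: "0 < l" and lo: "\<And>x y. l * dist x y \<le> norm (f x - f y)"
    and up: "\<And>x y. norm (f x - f y) \<le> L * dist x y"
    unfolding bilipschitz_embedding_def by blast
  define D where "D = dist (\<iota> u) (\<iota> v)"
  \<comment> \<open>Otherwise the singleton would be the only geodesic, against infinitely many
    marked ones. This gives the root positive length.\<close>
  have "\<iota> u \<noteq> \<iota> v"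
  proof
    assume "\<iota> u = \<iota> v"
    then have "marked \<subseteq> {{\<iota> u}}"
      using marked_geodesics geodesic_same_endpoints by fastforce
    then show False using infinitely_many finite_subset by blast
  qed
  define M where "M = restrict_space lborel {0..<D}"
  \<comment> \<open>Nondegenerate segments inside \<open>[0, D)\<close> whose end points share a
    marked geodesic: exactly such pairs can be refined by \<open>thick\<close>.\<close>
  define V where "V = {(p, q, s). p \<noteq> q \<and> 0 \<le> s \<and> s + dist p q \<le> D \<and> (\<exists>T\<in>marked. p \<in> T \<and> q \<in> T)}"
  define r where "r = (\<iota> u, \<iota> v, 0::real)"
  have space: "space M = {0..<D}" by (simp add: M_def space_restrict_space)
  have "emeasure M (space M) = D"
    unfolding space unfolding M_def using \<open>\<iota> u \<noteq> \<iota> v\<close> by (subst emeasure_restrict_space) (auto simp: D_def)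
  then interpret M: finite_measure M by (intro finite_measureI) simp
  have ivl: "seg_ivl j \<in> sets M" "measure M (seg_ivl j) = seg_len j" "0 < seg_len j" if "j \<in> V" for j
  proof -
    obtain p q s where j: "j = (p, q, s)" by (metis prod.exhaust)
    have sub: "seg_ivl j \<subseteq> {0..<D}" using that by (auto simp: j V_def)
    show "seg_ivl j \<in> sets M"
      unfolding M_def using sub by (subst sets_restrict_space_iff) (auto simp: j)
    show "measure M (seg_ivl j) = seg_len j"
      unfolding M_def using sub by (subst measure_restrict_space) (auto simp: j)
    show "0 < seg_len j" using that by (auto simp: j V_def)
  qed
  \<comment> \<open>All requirements on the children of \<open>j\<close> in one predicate, so that
    \<open>ch\<close> can be chosen at once. The last clause is the separation of the martingale,
    with measures written as lengths.\<close>
  define good where "good j C \<longleftrightarrow> finite C \<and> C \<subseteq> V \<and> disjoint_family_on seg_ivl C \<and>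
      (\<Union>i\<in>C. seg_ivl i) = seg_ivl j \<and> seg_diff f j = (\<Sum>i\<in>C. seg_diff f i) \<and>
      l / 2 * c * seg_len j \<le>
        (\<Sum>i\<in>C. norm (seg_diff f i - (seg_len i / seg_len j) *\<^sub>R seg_diff f j))" for j C
  have "\<exists>C. good j C" if "j \<in> V" for j
  proof -
    obtain p q s T where j: "j = (p, q, s)" and T: "T \<in> marked" "p \<in> T" "q \<in> T"
      and s: "0 \<le> s" "s + dist p q \<le> D" and "p \<noteq> q"
      using \<open>j \<in> V\<close> unfolding V_def by blast
    \<comment> \<open>The difference quotient of \<open>f\<close> over the segment, that is the
      value of the martingale on it.\<close>
    define e where "e = (1 / dist p q) *\<^sub>R (f q - f p)"
    obtain n w z z' T1 T2 where w: "w 0 = p" "w n = q"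
      and z: "T1 \<in> marked" "listed_in_order (\<iota> u) (\<iota> v) T1 (interleave n w z)"
      and z': "T2 \<in> marked" "listed_in_order (\<iota> u) (\<iota> v) T2 (interleave n w z')"
      and eq: "\<And>i. i \<in> {1..n} \<Longrightarrow> dist (w (i - 1)) (z i) = dist (w (i - 1)) (z' i)"
      and sum: "c * dist p q \<le> (\<Sum>i=1..n. dist (z i) (z' i))"
      using thick[rule_format, OF T] by blast
    obtain x where x: "x 0 = p" "x (2 * n) = q"
      and xT: "\<forall>m<2 * n. \<exists>T\<in>marked. x m \<in> T \<and> x (Suc m) \<in> T"
      and len: "(\<Sum>m<2 * n. dist (x m) (x (Suc m))) = dist p q"
      and dev: "l / 2 * (\<Sum>i=1..n. dist (z i) (z' i)) \<le>
        (\<Sum>m<2 * n. norm (f (x (Suc m)) - f (x m) - dist (x m) (x (Suc m)) *\<^sub>R e))"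
      by (rule thick_refinement[OF z z' eq lo, where e=e, unfolded w])
    from len obtain C where C: "finite C"
      "\<forall>j\<in>C. \<exists>m<2 * n. \<exists>t. j = (x m, x (Suc m), t) \<and> x m \<noteq> x (Suc m)"
      "disjoint_family_on seg_ivl C" "(\<Union>i\<in>C. seg_ivl i) = {s..<s + dist p q}"
      "(\<Sum>i\<in>C. seg_diff f i) = f q - f p"
      "(\<Sum>i\<in>C. norm (seg_diff f i - seg_len i *\<^sub>R e)) =
        (\<Sum>m<2 * n. norm (f (x (Suc m)) - f (x m) - dist (x m) (x (Suc m)) *\<^sub>R e))"
      by (rule subdivide_segment[where x=x and N="2 * n" and f=f and e=e and s=s, unfolded x])
    have "C \<subseteq> V"
    proof
      fix i assume "i \<in> C"
      then obtain m t where m: "m < 2 * n" and i: "i = (x m, x (Suc m), t)" and "x m \<noteq> x (Suc m)"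
        using C(2) by blast
      have "{t..<t + dist (x m) (x (Suc m))} \<subseteq> {s..<s + dist p q}"
        using C(4) \<open>i \<in> C\<close> i by fastforce
      \<comment> \<open>Containment of intervals orders their end points because the smaller one is
        nonempty.\<close>
      then have "s \<le> t" "t + dist (x m) (x (Suc m)) \<le> s + dist p q"
        using \<open>x m \<noteq> x (Suc m)\<close> by (auto simp: ivl_subset atLeastLessThan_subset_iff)
      then show "i \<in> V" using s \<open>x m \<noteq> x (Suc m)\<close> xT[rule_format, OF m] by (auto simp: V_def i)
    qed
    moreover have "l / 2 * c * dist p q \<le> l / 2 * (\<Sum>i=1..n. dist (z i) (z' i))"
      using mult_left_mono[OF sum, of "l / 2"] l by (simp add: mult.assoc)
    moreover have "seg_len i *\<^sub>R e = (seg_len i / dist p q) *\<^sub>R (f q - f p)" for i :: "'b \<times> 'b \<times> real"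
      by (simp add: e_def)
    ultimately have "good j C"
      unfolding good_def using C dev by (simp add: j)
    then show ?thesis by blast
  qed
  then obtain ch where good_ch: "\<And>j. j \<in> V \<Longrightarrow> good j (ch j)" by metis
  have ch: "finite (ch j)" "ch j \<subseteq> V" "disjoint_family_on seg_ivl (ch j)"
      "(\<Union>i\<in>ch j. seg_ivl i) = seg_ivl j" "seg_diff f j = (\<Sum>i\<in>ch j. seg_diff f i)"
      "l / 2 * c * seg_len j \<le>
        (\<Sum>i\<in>ch j. norm (seg_diff f i - (seg_len i / seg_len j) *\<^sub>R seg_diff f j))"
    if "j \<in> V" for j
    using good_ch[OF that] unfolding good_def by - (elim conjE; assumption)+
  have "additive_tree M V seg_ivl ch (seg_diff f) L r"
  proof unfold_locales
    \<comment> \<open>Infinitely many marked geodesics provide at least one, and it contains both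
      end points of the root segment.\<close>
    obtain T where T: "T \<in> marked" using infinitely_many by fastforce
    then have "is_geodesic (\<iota> u) (\<iota> v) T" using marked_geodesics by blast
    then have "\<iota> u \<in> T \<and> \<iota> v \<in> T"
      unfolding is_geodesic_def geodesic_param_def
      by (metis atLeastAtMost_iff imageI order_refl zero_le_dist)
    then show "r \<in> V" using T \<open>\<iota> u \<noteq> \<iota> v\<close> by (auto simp: r_def V_def D_def)
    show "seg_ivl r = space M" by (simp add: space r_def D_def)
    show "norm (seg_diff f j) \<le> L * measure M (seg_ivl j)" if "j \<in> V" for j
      unfolding ivl(2)[OF that] using up
      by (cases j) (metis dist_commute seg_diff.simps seg_len.simps)
  qed (use ch ivl in auto)
  then show False
  proof (rule RNP_no_separated_tree[OF _ RNP])
    \<comment> \<open>The factor \<open>l / 2\<close> comes from choosing the better of two twins,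
      \<open>c\<close> from the thickness of the family.\<close>
    show "l / 2 * c > 0" using l c_pos by simp
    fix j assume j: "j \<in> V"
    have "measure M (seg_ivl i) = seg_len i" if "i \<in> ch j" for i
      using ivl(2) ch(2)[OF j] that by blast
    then show "l / 2 * c * measure M (seg_ivl j) \<le> (\<Sum>i\<in>ch j. norm (seg_diff f i -
        (measure M (seg_ivl i) / measure M (seg_ivl j)) *\<^sub>R seg_diff f j))"
      using ch(6)[OF j] by (simp add: ivl(2)[OF j])
  qed
qed

end
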